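(* Let $\alpha\in(0,1]$ and let $\boldsymbol{Y}$ be a random vector in $[0,\infty)^n$ with joint Laplace transform $$\mathbb{E}\left(e^{-\langle\boldsymbol{Y},\boldsymbol{\theta}\rangle}\right)=\boldsymbol{\pi}\left(\boldsymbol{\Delta}(\boldsymbol{R}\boldsymbol{\theta})^\alpha-\boldsymbol{T}\right)^{-1}\boldsymbol{t},\qquad \boldsymbol{\theta}\in[0,\infty)^n.$$ Then $$\boldsymbol{Y}\stackrel{d}{=}\boldsymbol{R}^{T}\left(\boldsymbol{W}^{1/\alpha}\bullet\boldsymbol{S}_\alpha\right),$$ where $\boldsymbol{W}^{1/\alpha}=(W_1^{1/\alpha},\dots,W_p^{1/\alpha})$ with $\boldsymbol{W}=(W_1,\dots,W_p)\sim\mathrm{MPH}^*(\boldsymbol{\pi},\boldsymbol{T},\boldsymbol{I})$, where $\boldsymbol{S}_\alpha=(S_\alpha^1,\dots,S_\alpha^p)$ is a vector, independent of $\boldsymbol{W}$, of independent positive stable random variables, each with Laplace transform $u\mapsto\exp(-u^\alpha)$, and where $\bullet$ denotes entrywise (Schur) multiplication of vectors.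
   Context: Here $\boldsymbol{\pi}=(\pi_1,\dots,\pi_p)$ is a row vector of probabilities summing to $1$; $\boldsymbol{T}$ is a $p\times p$ sub-intensity matrix of transient states (negative diagonal entries, non-negative off-diagonal entries, $\boldsymbol{t}:=-\boldsymbol{T}\boldsymbol{e}\ge\boldsymbol{0}$ entrywise with $\boldsymbol{e}$ the column vector of ones, $\boldsymbol{T}$ invertible); $\boldsymbol{R}$ is a $p\times n$ matrix with non-negative entries; $\boldsymbol{I}$ is the $p\times p$ identity matrix. $\boldsymbol{\Delta}(\boldsymbol{v})$ is the diagonal matrix with diagonal $\boldsymbol{v}$, and $\boldsymbol{\Delta}(\boldsymbol{R}\boldsymbol{\theta})^\alpha$ is the diagonal matrix with entries $((\boldsymbol{R}\boldsymbol{\theta})_i)^\alpha$, $i=1,\dots,p$ (with $0^\alpha=0$). Kulkarni's class: for a $p\times m$ non-negative matrix $\boldsymbol{M}=\{m_{ik}\}$, $\mathrm{MPH}^*(\boldsymbol{\pi},\boldsymbol{T},\boldsymbol{M})$ is the distribution of $(W_1,\dots,W_m)$ with $W_k=\int_0^\tau\sum_{i=1}^p m_{ik}1\{X_t=i\}\,dt$, where $\{X_t\}$ is a Markov jump process on $\{1,\dots,p,p+1\}$ with initial distribution $\boldsymbol{\pi}$ on $\{1,\dots,p\}$ and intensity matrix $\begin{pmatrix}\boldsymbol{T}&\boldsymbol{t}\\ \boldsymbol{0}&0\end{pmatrix}$, and $\tau$ is its time of absorption in state $p+1$. Its joint Laplace transform is $\mathbb{E}(e^{-\langle\boldsymbol{W},\boldsymbol{\theta}\rangle})=\boldsymbol{\pi}(\boldsymbol{\Delta}(\boldsymbol{M}\boldsymbol{\theta})-\boldsymbol{T})^{-1}\boldsymbol{t}$.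 *)

theory Defs
  imports "HOL-Probability.Probability"
begin

section \<open>Parameters\<close>

definition diag_mat :: "real^'p \<Rightarrow> real^'p^'p" where
  "diag_mat v = (\<chi> i j. if i = j then v $ i else 0)"

text \<open>Only used for non-negative \<open>v\<close> and \<open>a > 0\<close>; note that \<open>0 powr a = 0\<close>.\<close>

definition vec_powr :: "real^'p \<Rightarrow> real \<Rightarrow> real^'p" where
  "vec_powr v a = (\<chi> i. (v $ i) powr a)"

definition schur_mult :: "real^'p \<Rightarrow> real^'p \<Rightarrow> real^'p" where
  "schur_mult v w = (\<chi> i. v $ i * w $ i)"

definition probability_vector :: "real^'p \<Rightarrow> bool" where
  "probability_vector \<pi> \<longleftrightarrow> (\<forall>i. 0 \<le> \<pi> $ i) \<and> (\<Sum>i\<in>UNIV. \<pi> $ i) = 1"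

definition exit_rates :: "real^'p^'p \<Rightarrow> real^'p" where
  "exit_rates T = - (T *v (\<chi> i. 1))"

definition sub_intensity_matrix :: "real^'p^'p \<Rightarrow> bool" where
  "sub_intensity_matrix T \<longleftrightarrow>
     (\<forall>i. T $ i $ i < 0) \<and> (\<forall>i j. i \<noteq> j \<longrightarrow> 0 \<le> T $ i $ j) \<and>
     (\<forall>i. 0 \<le> exit_rates T $ i) \<and> invertible T"

definition nonneg_matrix :: "real^'n^'p \<Rightarrow> bool" where
  "nonneg_matrix A \<longleftrightarrow> (\<forall>i j. 0 \<le> A $ i $ j)"


section \<open>Markov jump processes on a finite state space\<close>

definition transition_semigroup ::
  "('s::finite \<Rightarrow> 's \<Rightarrow> real) \<Rightarrow> (real \<Rightarrow> 's \<Rightarrow> 's \<Rightarrow> real) \<Rightarrow> bool" where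
  "transition_semigroup Q P \<longleftrightarrow>
     (\<forall>t\<ge>0. \<forall>i j. 0 \<le> P t i j) \<and>
     (\<forall>t\<ge>0. \<forall>i. (\<Sum>j\<in>UNIV. P t i j) = 1) \<and>
     (\<forall>i j. P 0 i j = (if i = j then 1 else 0)) \<and>
     (\<forall>s\<ge>0. \<forall>t\<ge>0. \<forall>i j. P (s + t) i j = (\<Sum>k\<in>UNIV. P s i k * P t k j)) \<and>
     (\<forall>i j. ((\<lambda>t. P t i j) has_real_derivative Q i j) (at_right 0))"

text \<open>A time-homogeneous Markov process indexed by \<open>[0,\<infinity>)\<close> with intensity matrix \<open>Q\<close>, initial
  distribution \<open>p0\<close> and piecewise constant paths (right-continuous with left limits for the
  discrete topology, hence with finitely many jumps in bounded intervals). The Markov property is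
  written without division by the probability of the conditioning event.\<close>

definition markov_jump_process ::
  "'b measure \<Rightarrow> (real \<Rightarrow> 'b \<Rightarrow> 's::finite) \<Rightarrow> ('s \<Rightarrow> real) \<Rightarrow> ('s \<Rightarrow> 's \<Rightarrow> real) \<Rightarrow> bool" where
  "markov_jump_process N X p0 Q \<longleftrightarrow>
     prob_space N \<and>
     (\<forall>t\<ge>0. X t \<in> measurable N (count_space UNIV)) \<and>
     (\<forall>\<omega>\<in>space N. \<forall>t\<ge>0. \<forall>\<^sub>F s in at_right t. X s \<omega> = X t \<omega>) \<and>
     (\<forall>\<omega>\<in>space N. \<forall>t>0. \<exists>x. \<forall>\<^sub>F s in at_left t. X s \<omega> = x) \<and>
     (\<forall>x. measure N {\<omega> \<in> space N. X 0 \<omega> = x} = p0 x) \<and>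
     (\<exists>P. transition_semigroup Q P \<and>
       (\<forall>(n::nat) (t::nat \<Rightarrow> real) (x::nat \<Rightarrow> 's).
          0 \<le> t 0 \<and> (\<forall>k\<le>n. t k \<le> t (Suc k)) \<longrightarrow>
          measure N {\<omega> \<in> space N. \<forall>k\<le>Suc n. X (t k) \<omega> = x k} =
          measure N {\<omega> \<in> space N. \<forall>k\<le>n. X (t k) \<omega> = x k} *
            P (t (Suc n) - t n) (x n) (x (Suc n))))"


section \<open>Kulkarni's multivariate phase-type distributions\<close>

text \<open>The state space is \<open>'p option\<close>: \<open>Some i\<close> are the transient states and \<open>None\<close> is the
  absorbing state.\<close>

fun absorbing_intensity :: "real^'p^'p \<Rightarrow> 'p option \<Rightarrow> 'p option \<Rightarrow> real" where
  "absorbing_intensity T (Some i) (Some j) = T $ i $ j"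
| "absorbing_intensity T (Some i) None = exit_rates T $ i"
| "absorbing_intensity T None _ = 0"

fun transient_initial :: "real^'p \<Rightarrow> 'p option \<Rightarrow> real" where
  "transient_initial \<pi> (Some i) = \<pi> $ i"
| "transient_initial \<pi> None = 0"

text \<open>The infimum is taken in the extended reals, so it is \<open>\<infinity>\<close> if there is no absorption.\<close>

definition absorption_time :: "(real \<Rightarrow> 'b \<Rightarrow> 'p option) \<Rightarrow> 'b \<Rightarrow> ereal" where
  "absorption_time X \<omega> = (INF t\<in>{t. 0 \<le> t \<and> X t \<omega> = None}. ereal t)"

definition total_reward ::
  "(real \<Rightarrow> 'b \<Rightarrow> 'p::finite option) \<Rightarrow> real^'m^'p \<Rightarrow> 'b \<Rightarrow> real^'m" where
  "total_reward X A \<omega> =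
     (\<chi> k. LBINT t=0..absorption_time X \<omega>.
        (\<Sum>i\<in>UNIV. A $ i $ k * (if X t \<omega> = Some i then 1 else 0)))"

text \<open>\<open>MPH_star TYPE('b) \<pi> T A \<mu>\<close>: the law \<open>\<mu>\<close> is \<open>MPH\<^sup>*(\<pi>, T, A)\<close>, realised by a process on a
  probability space with sample type \<open>'b\<close>. HOL cannot quantify existentially over this type, so
  it is a parameter.\<close>

definition MPH_star ::
  "'b itself \<Rightarrow> real^'p \<Rightarrow> real^'p^'p \<Rightarrow> real^'m^'p \<Rightarrow> (real^'m) measure \<Rightarrow> bool" where
  "MPH_star _ \<pi> T A \<mu> \<longleftrightarrow>
     (\<exists>(N :: 'b measure) X.
        markov_jump_process N X (transient_initial \<pi>) (absorbing_intensity T) \<and>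
        \<mu> = distr N borel (total_reward X A))"


section \<open>Positive stable random variables\<close>

text \<open>For \<open>\<alpha> = 1\<close> this is the constant 1.\<close>

definition positive_stable_rv :: "real \<Rightarrow> 'c measure \<Rightarrow> ('c \<Rightarrow> real) \<Rightarrow> bool" where
  "positive_stable_rv \<alpha> M S \<longleftrightarrow>
     S \<in> borel_measurable M \<and> (AE \<omega> in M. 0 < S \<omega>) \<and>
     (\<forall>u\<ge>0. (\<integral>\<omega>. exp (- (u * S \<omega>)) \<partial>M) = exp (- (u powr \<alpha>)))"

end

theory Submission
  imports Defs
begin

text \<open>The two vectors have the same Laplace transform, and the Laplace transform determines the law of
  a random vector in the non-negative orthant (\<open>laplace_transform_unique\<close>).

  To compute the transform of the right-hand side at \<open>\<theta>\<close>, put \<open>c = R \<theta>\<close> and condition on \<open>W = w\<close>. The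
  transform factorises over the coordinates of the stable vector, and the factor of the coordinate
  \<open>i\<close> is \<open>exp (- (w\<^sub>i\<^sup>1\<^sup>/\<^sup>\<alpha> c\<^sub>i)\<^sup>\<alpha>) = exp (- w\<^sub>i c\<^sub>i\<^sup>\<alpha>)\<close>. The scaling by \<open>W\<^sup>1\<^sup>/\<^sup>\<alpha>\<close> therefore yields the
  transform of \<open>W\<close> at the point with coordinates \<open>c\<^sub>i\<^sup>\<alpha>\<close> (\<open>laplace_stable_mixture\<close>). What remains is
  Kulkarni's formula \<open>\<pi> (\<Delta>(\<theta>) - T)\<^sup>-\<^sup>1 t\<close> for the transform of the vector of total sojourn times
  (\<open>laplace_total_reward\<close>).

  Kulkarni's formula comes from the skeleton of the jump process on a grid of mesh \<open>h\<close>. Let \<open>P\<^sub>h\<close> be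
  the transition matrix between transient states, \<open>p\<^sub>h\<close> the vector of absorption probabilities in one
  step and \<open>D\<^sub>h\<close> the diagonal matrix with entries \<open>exp (- h \<theta>\<^sub>i)\<close>. A solution of
  \<open>u = P\<^sub>h D\<^sub>h u + p\<^sub>h\<close>, extended by the value 1 at the absorbing state, is harmonic for the discounted
  chain, so its discounted expectation after \<open>K\<close> steps equals \<open>\<pi> u\<close> for every \<open>K\<close>. Divided by \<open>h\<close>,
  the linear system for \<open>u\<close> converges to \<open>(\<Delta>(\<theta>) - T) u = t\<close>. Along almost every path the discount
  factor is the exponential of Riemann sums that converge to the sojourn times, because
  paths are right-continuous step functions that are eventually absorbed. Dominated convergence then
  gives the formula without matrix exponentials.

  Two facts on matrices are needed: \<open>\<Delta>(\<theta>) - T\<close> is invertible for all \<open>\<theta> \<ge> 0\<close>, and absorption is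
  almost sure. Both follow from the observation that the powers of a substochastic matrix without a
  nonzero fixed vector tend to 0 (\<open>substochastic_iterates_vanish\<close>).\<close>


section \<open>Uniqueness of multivariate Laplace transforms\<close>

lemma borel_measurable_vec_nth [measurable (raw)]:
  fixes f :: "'a \<Rightarrow> real^'n"
  assumes "f \<in> borel_measurable M"
  shows "(\<lambda>x. f x $ i) \<in> borel_measurable M"
  using assms by (rule measurable_compose[OF _ borel_measurable_nth])

lemma borel_measurable_vec_componentwise:
  fixes f :: "'a \<Rightarrow> real^'n"
  assumes "\<And>i. (\<lambda>x. f x $ i) \<in> borel_measurable M"
  shows "f \<in> borel_measurable M"
  using assms
  by (subst borel_measurable_euclidean_space) (auto simp: Basis_vec_def inner_axis)

text \<open>This map sends the non-negative orthant into the unit cube and turns values of the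
  Laplace transform at integer points into mixed moments.\<close>
definition exp_neg :: "real^'n \<Rightarrow> real^'n" where
  "exp_neg x = (\<chi> j. exp (- (x $ j)))"

lemma exp_neg_measurable [measurable]: "exp_neg \<in> borel_measurable borel"
  unfolding exp_neg_def by (intro borel_measurable_continuous_onI continuous_intros continuous_on_vec_lambda)

text \<open>Monomials in \<open>exp_neg x\<close> are the exponentials \<open>exp (- (x \<bullet> \<theta>))\<close> with entries of
  \<open>\<theta>\<close> in the natural numbers, so equal Laplace transforms give equal integrals of
  monomials. Normal forms of multivariate polynomials are avoided as follows: equality of integrals is not preserved by products of functions, but the
  multipliers of a class of functions always form an algebra.\<close>
lemma integral_polynomial_exp_neg_eq:
  fixes \<mu> \<nu> :: "(real^'n) measure"
  assumes "prob_space \<mu>" "prob_space \<nu>"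
    and [measurable_cong]: "sets \<mu> = sets borel" "sets \<nu> = sets borel"
    and nonneg: "AE x in \<mu>. \<forall>j. 0 \<le> x $ j" "AE x in \<nu>. \<forall>j. 0 \<le> x $ j"
    and laplace: "\<And>\<theta>. (\<forall>j. 0 \<le> \<theta> $ j) \<Longrightarrow>
      (\<integral>x. exp (- (x \<bullet> \<theta>)) \<partial>\<mu>) = (\<integral>x. exp (- (x \<bullet> \<theta>)) \<partial>\<nu>)"
    and "real_polynomial_function p"
  shows "(\<integral>x. p (exp_neg x) \<partial>\<mu>) = (\<integral>x. p (exp_neg x) \<partial>\<nu>)"
proof -
  interpret \<mu>: prob_space \<mu> by fact
  interpret \<nu>: prob_space \<nu> by fact
  \<comment> \<open>\<open>G\<close> is the class of test functions, \<open>H\<close> the algebra of its multipliers.\<close>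
  define G :: "(real^'n \<Rightarrow> real) \<Rightarrow> bool" where "G g \<longleftrightarrow> g \<in> borel_measurable borel \<and>
     (\<exists>B. \<forall>x. (\<forall>j. 0 \<le> x $ j) \<longrightarrow> \<bar>g x\<bar> \<le> B) \<and>
     (\<forall>\<theta>. (\<forall>j. 0 \<le> \<theta> $ j) \<longrightarrow>
        (\<integral>x. g x * exp (- (x \<bullet> \<theta>)) \<partial>\<mu>) = (\<integral>x. g x * exp (- (x \<bullet> \<theta>)) \<partial>\<nu>))" for g
  define H where "H f \<longleftrightarrow> (\<forall>g. G g \<longrightarrow> G (\<lambda>x. f x * g x))" for f
  have G_int: "integrable \<mu> (\<lambda>x. g x * exp (- (x \<bullet> \<theta>)))"
    "integrable \<nu> (\<lambda>x. g x * exp (- (x \<bullet> \<theta>)))" if "G g" and \<theta>: "\<forall>j. 0 \<le> \<theta> $ j" for g \<theta>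
  proof -
    from \<open>G g\<close> obtain B where [measurable]: "g \<in> borel_measurable borel"
      and B: "\<And>x. (\<forall>j. 0 \<le> x $ j) \<Longrightarrow> \<bar>g x\<bar> \<le> B" unfolding G_def by blast
    have *: "norm (g x * exp (- (x \<bullet> \<theta>))) \<le> B" if x: "\<forall>j. 0 \<le> x $ j" for x
    proof -
      have "0 \<le> x \<bullet> \<theta>" unfolding inner_vec_def using x \<theta> by (auto intro: sum_nonneg)
      then have "\<bar>g x\<bar> * exp (- (x \<bullet> \<theta>)) \<le> B * 1"
        using B[OF x] by (intro mult_mono) auto
      then show ?thesis by (simp add: abs_mult)
    qed
    show "integrable \<mu> (\<lambda>x. g x * exp (- (x \<bullet> \<theta>)))"
      by (rule \<mu>.integrable_const_bound[where B = B]) (use nonneg * in auto)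
    show "integrable \<nu> (\<lambda>x. g x * exp (- (x \<bullet> \<theta>)))"
      by (rule \<nu>.integrable_const_bound[where B = B]) (use nonneg * in auto)
  qed
  have G_add: "G (\<lambda>x. f x + g x)" if "G f" "G g" for f g
  proof -
    from that obtain B C where "\<And>x. (\<forall>j. 0 \<le> x $ j) \<Longrightarrow> \<bar>f x\<bar> \<le> B"
      "\<And>x. (\<forall>j. 0 \<le> x $ j) \<Longrightarrow> \<bar>g x\<bar> \<le> C" unfolding G_def by blast
    then have "\<forall>x. (\<forall>j. 0 \<le> x $ j) \<longrightarrow> \<bar>f x + g x\<bar> \<le> B + C"
      by (meson abs_triangle_ineq add_mono order_trans)
    moreover have "(\<integral>x. (f x + g x) * exp (- (x \<bullet> \<theta>)) \<partial>\<mu>) = (\<integral>x. (f x + g x) * exp (- (x \<bullet> \<theta>)) \<partial>\<nu>)"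
      if "\<forall>j. 0 \<le> \<theta> $ j" for \<theta>
      using G_int[OF \<open>G f\<close> that] G_int[OF \<open>G g\<close> that] \<open>G f\<close> \<open>G g\<close> that
      by (simp add: distrib_right G_def)
    ultimately show ?thesis using \<open>G f\<close> \<open>G g\<close> unfolding G_def by auto
  qed
  have G_scale: "G (\<lambda>x. c * g x)" if "G g" for c g
  proof -
    from that obtain B where "\<And>x. (\<forall>j. 0 \<le> x $ j) \<Longrightarrow> \<bar>g x\<bar> \<le> B" unfolding G_def by blast
    then have "\<forall>x. (\<forall>j. 0 \<le> x $ j) \<longrightarrow> \<bar>c * g x\<bar> \<le> \<bar>c\<bar> * B"
      by (simp add: abs_mult mult_left_mono)
    then show ?thesis using \<open>G g\<close> unfolding G_def by (auto simp: mult.assoc)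
  qed
  have H_const: "H (\<lambda>x. c)" for c unfolding H_def using G_scale by blast
  have H_add: "H (\<lambda>x. f x + g x)" if "H f" "H g" for f g
    using that G_add unfolding H_def by (auto simp: distrib_right)
  have H_mult: "H (\<lambda>x. f x * g x)" if "H f" "H g" for f g
    using that unfolding H_def by (auto simp: mult.assoc)
  have H_sum: "H (\<lambda>x. \<Sum>j\<in>J. f j x)" if "finite J" "\<And>j. j \<in> J \<Longrightarrow> H (f j)" for J :: "'n set" and f
    using that by (induction J rule: finite_induct) (auto intro: H_const H_add)
  have H_coord: "H (\<lambda>x. exp_neg x $ j)" for j
    unfolding H_def
  proof (intro allI impI)
    fix g assume "G g"
    then obtain B where [measurable]: "g \<in> borel_measurable borel"
      and B: "\<And>x. (\<forall>j. 0 \<le> x $ j) \<Longrightarrow> \<bar>g x\<bar> \<le> B" unfolding G_def by blast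
    \<comment> \<open>Multiplication by the \<open>j\<close>-th coordinate of \<open>exp_neg x\<close> shifts \<open>\<theta>\<close> by a unit vector.\<close>
    have eq: "exp_neg x $ j * g x * exp (- (x \<bullet> \<theta>)) = g x * exp (- (x \<bullet> (\<theta> + axis j 1)))" for x \<theta>
      by (simp add: exp_neg_def inner_add_right inner_axis flip: exp_add)
    have bd: "\<bar>exp_neg x $ j * g x\<bar> \<le> B" if "\<forall>j. 0 \<le> x $ j" for x
    proof -
      have "exp_neg x $ j * \<bar>g x\<bar> \<le> 1 * B"
        using that B[OF that] by (intro mult_mono) (auto simp: exp_neg_def)
      then show ?thesis by (simp add: abs_mult exp_neg_def)
    qed
    have [measurable]: "(\<lambda>x. exp_neg x $ j * g x) \<in> borel_measurable borel"
      by (simp add: exp_neg_def)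
    have "(\<integral>x. exp_neg x $ j * g x * exp (- (x \<bullet> \<theta>)) \<partial>\<mu>) = (\<integral>x. exp_neg x $ j * g x * exp (- (x \<bullet> \<theta>)) \<partial>\<nu>)"
      if "\<forall>j. 0 \<le> \<theta> $ j" for \<theta>
      unfolding eq using \<open>G g\<close> that unfolding G_def by (auto simp: axis_def)
    with bd show "G (\<lambda>x. exp_neg x $ j * g x)" unfolding G_def by auto
  qed
  have "H (\<lambda>x. p (exp_neg x))"
    using \<open>real_polynomial_function p\<close>
  proof induction
    case (linear f)
    have "f y = (\<Sum>j\<in>UNIV. y $ j * f (axis j 1))" for y
    proof -
      have "f y = f (\<Sum>j\<in>UNIV. y $ j *\<^sub>R axis j 1)"
        by (simp add: basis_expansion flip: scalar_mult_eq_scaleR)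
      also have "\<dots> = (\<Sum>j\<in>UNIV. y $ j * f (axis j 1))"
        using linear by (simp add: bounded_linear.linear linear_sum linear_cmul)
      finally show ?thesis .
    qed
    then have "(\<lambda>x. f (exp_neg x)) = (\<lambda>x. \<Sum>j\<in>UNIV. exp_neg x $ j * f (axis j 1))"
      by (intro ext)
    then show ?case by (auto intro!: H_sum H_mult H_coord H_const)
  qed (auto intro: H_const H_add H_mult)
  moreover have "G (\<lambda>x. 1)" unfolding G_def using laplace by auto
  ultimately have "G (\<lambda>x. p (exp_neg x))" unfolding H_def by fastforce
  moreover have "\<forall>j. 0 \<le> (0 :: real^'n) $ j" by simp
  ultimately have "(\<integral>x. p (exp_neg x) * exp (- (x \<bullet> 0)) \<partial>\<mu>) = (\<integral>x. p (exp_neg x) * exp (- (x \<bullet> 0)) \<partial>\<nu>)"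
    unfolding G_def by blast
  then show ?thesis by simp
qed

lemma measure_eqI_closed:
  fixes \<mu> \<nu> :: "'a::metric_space measure"
  assumes "sets \<mu> = sets borel" "sets \<nu> = sets borel" "finite_measure \<mu>"
    and "\<And>C. closed C \<Longrightarrow> emeasure \<mu> C = emeasure \<nu> C"
  shows "\<mu> = \<nu>"
proof (rule measure_eqI_generator_eq[where E = "Collect closed" and \<Omega> = UNIV and A = "\<lambda>_. UNIV"])
  show "Int_stable (Collect closed)" by (auto simp: Int_stable_def)
  show "emeasure \<mu> UNIV \<noteq> \<infinity>"
    using finite_measure.emeasure_finite[OF assms(3)] by auto
  have "sets borel = sigma_sets UNIV (Collect (closed :: 'a set \<Rightarrow> bool))"
    unfolding borel_eq_closed by (rule sets_measure_of) simp
  then show "sets \<mu> = sigma_sets UNIV (Collect closed)" "sets \<nu> = sigma_sets UNIV (Collect closed)"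
    using assms by simp_all
qed (use assms in auto)

text \<open>By the Weierstrass approximation theorem on the unit cube, the images of both measures under
  \<open>exp_neg\<close> give the same integral to every continuous function, hence the same mass to every closed
  set. The logarithm then recovers the measures from their images.\<close>
lemma laplace_transform_unique:
  fixes \<mu> \<nu> :: "(real^'n) measure"
  assumes "prob_space \<mu>" "prob_space \<nu>"
    and sets_\<mu>\<nu> [measurable_cong]: "sets \<mu> = sets borel" "sets \<nu> = sets borel"
    and nonneg: "AE x in \<mu>. \<forall>j. 0 \<le> x $ j" "AE x in \<nu>. \<forall>j. 0 \<le> x $ j"
    and laplace: "\<And>\<theta>. (\<forall>j. 0 \<le> \<theta> $ j) \<Longrightarrow>
      (\<integral>x. exp (- (x \<bullet> \<theta>)) \<partial>\<mu>) = (\<integral>x. exp (- (x \<bullet> \<theta>)) \<partial>\<nu>)"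
  shows "\<mu> = \<nu>"
proof -
  interpret \<mu>: prob_space \<mu> by fact
  interpret \<nu>: prob_space \<nu> by fact
  define K :: "(real^'n) set" where "K = cbox 0 1"
  have in_K: "exp_neg x \<in> K" if "\<forall>j. 0 \<le> x $ j" for x
    using that by (auto simp: K_def exp_neg_def mem_box_cart)
  have cont: "(\<integral>x. f (exp_neg x) \<partial>\<mu>) = (\<integral>x. f (exp_neg x) \<partial>\<nu>)"
    if f: "continuous_on UNIV f" for f :: "real^'n \<Rightarrow> real"
  proof -
    have fm [measurable]: "f \<in> borel_measurable borel" using f by (rule borel_measurable_continuous_onI)
    have close: "\<bar>(\<integral>x. f (exp_neg x) \<partial>\<mu>) - (\<integral>x. f (exp_neg x) \<partial>\<nu>)\<bar> \<le> 2 * e" if "0 < e" for e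
    proof -
      have "compact K" by (simp add: K_def compact_cbox)
      then obtain p where p: "real_polynomial_function p" "\<And>x. x \<in> K \<Longrightarrow> \<bar>f x - p x\<bar> < e"
        using Stone_Weierstrass_real_polynomial_function[of K f e] f \<open>0 < e\<close> continuous_on_subset
        by (metis subset_UNIV)
      have contp: "continuous_on UNIV p"
        using p(1) by (simp add: continuous_on_polymonial_function real_polynomial_function_eq)
      then have [measurable]: "p \<in> borel_measurable borel" by (rule borel_measurable_continuous_onI)
      obtain B where B: "\<And>y. y \<in> K \<Longrightarrow> \<bar>f y\<bar> \<le> B"
        using compact_imp_bounded[OF compact_continuous_image[OF _ \<open>compact K\<close>, of f]] f
        by (metis bounded_real continuous_on_subset imageI subset_UNIV)
      have step: "\<bar>(\<integral>x. f (exp_neg x) \<partial>\<rho>) - (\<integral>x. p (exp_neg x) \<partial>\<rho>)\<bar> \<le> e"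
        if "prob_space \<rho>" "sets \<rho> = sets borel" and nn: "AE x in \<rho>. \<forall>j. 0 \<le> x $ j" for \<rho>
      proof -
        interpret \<rho>: prob_space \<rho> by fact
        have [measurable_cong]: "sets \<rho> = sets borel" by fact
        have intf: "integrable \<rho> (\<lambda>x. f (exp_neg x))"
          by (rule \<rho>.integrable_const_bound[where B = B]) (use nn B in_K in auto)
        have ae: "AE x in \<rho>. \<bar>f (exp_neg x) - p (exp_neg x)\<bar> \<le> e"
          using nn by eventually_elim (use p(2) in_K less_imp_le in blast)
        have intp: "integrable \<rho> (\<lambda>x. p (exp_neg x))"
        proof (rule \<rho>.integrable_const_bound[where B = "B + e"])
          show "AE x in \<rho>. norm (p (exp_neg x)) \<le> B + e"
            using nn ae
          proof eventually_elim
            case (elim x)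
            then show ?case using B[OF in_K[OF elim(1)]] by auto
          qed
        qed simp
        have "\<bar>\<integral>x. f (exp_neg x) - p (exp_neg x) \<partial>\<rho>\<bar> \<le> (\<integral>x. \<bar>f (exp_neg x) - p (exp_neg x)\<bar> \<partial>\<rho>)"
          using integral_norm_bound[of \<rho> "\<lambda>x. f (exp_neg x) - p (exp_neg x)"] by simp
        also have "\<dots> \<le> e"
          using \<rho>.integral_le_const[of "\<lambda>x. \<bar>f (exp_neg x) - p (exp_neg x)\<bar>" e] intf intp ae by auto
        finally show ?thesis using intf intp by simp
      qed
      have "(\<integral>x. p (exp_neg x) \<partial>\<mu>) = (\<integral>x. p (exp_neg x) \<partial>\<nu>)"
        by (rule integral_polynomial_exp_neg_eq[OF assms p(1)])
      with step[OF \<open>prob_space \<mu>\<close> sets_\<mu>\<nu>(1) nonneg(1)] step[OF \<open>prob_space \<nu>\<close> sets_\<mu>\<nu>(2) nonneg(2)]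
      show ?thesis by linarith
    qed
    show ?thesis
    proof (rule ccontr)
      assume "\<not> ?thesis"
      then show False
        using close[of "\<bar>(\<integral>x. f (exp_neg x) \<partial>\<mu>) - (\<integral>x. f (exp_neg x) \<partial>\<nu>)\<bar> / 3"] by auto
    qed
  qed
  have closed_eq: "emeasure (distr \<mu> borel exp_neg) C = emeasure (distr \<nu> borel exp_neg) C" if "closed C" for C
  proof (cases "C = {}")
    case False
    \<comment> \<open>Continuous functions that decrease to the indicator of the closed set \<open>C\<close>.\<close>
    define f where "f n x = max 0 (1 - real n * infdist x C)" for n :: nat and x :: "real^'n"
    have f_cont: "continuous_on UNIV (f n)" for n
      unfolding f_def by (intro continuous_intros)
    then have [measurable]: "f n \<in> borel_measurable borel" for n
      by (rule borel_measurable_continuous_onI)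
    have f_bound: "\<bar>f n x\<bar> \<le> 1" for n x by (simp add: f_def infdist_nonneg)
    have lim: "(\<lambda>n. f n x) \<longlonglongrightarrow> indicator C x" for x
    proof (cases "x \<in> C")
      case True then show ?thesis by (simp add: f_def)
    next
      case False
      then have "0 < infdist x C"
        using \<open>closed C\<close> \<open>C \<noteq> {}\<close> by (metis in_closed_iff_infdist_zero infdist_nonneg less_eq_real_def)
      then obtain n0 :: nat where n0: "1 < real n0 * infdist x C" using reals_Archimedean3 by blast
      have "f n x = 0" if "n \<ge> n0" for n
      proof -
        have "real n0 * infdist x C \<le> real n * infdist x C"
          using that \<open>0 < infdist x C\<close> by (intro mult_right_mono) auto
        then show ?thesis using n0 by (simp add: f_def)
      qed
      then have "\<forall>\<^sub>F n in sequentially. f n x = indicator C x"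
        using False by (auto simp: eventually_sequentially)
      then show ?thesis by (rule tendsto_eventually)
    qed
    have [measurable]: "C \<in> sets borel" using that by simp
    have main: "(\<lambda>n. \<integral>x. f n (exp_neg x) \<partial>\<rho>) \<longlonglongrightarrow> measure (distr \<rho> borel exp_neg) C"
      if "prob_space \<rho>" "sets \<rho> = sets borel" for \<rho>
    proof -
      interpret \<rho>: prob_space \<rho> by fact
      have [measurable_cong]: "sets \<rho> = sets borel" by fact
      have "(\<lambda>n. \<integral>x. f n (exp_neg x) \<partial>\<rho>) \<longlonglongrightarrow> (\<integral>x. indicat_real C (exp_neg x) \<partial>\<rho>)"
        by (rule integral_dominated_convergence[where w = "\<lambda>_. 1"])
           (use lim f_bound in auto)
      also have "(\<integral>x. indicat_real C (exp_neg x) \<partial>\<rho>) = (\<integral>y. indicat_real C y \<partial>distr \<rho> borel exp_neg)"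
        by (rule integral_distr[symmetric, where f = "indicat_real C"]) auto
      also have "\<dots> = measure (distr \<rho> borel exp_neg) C"
        by simp
      finally show ?thesis .
    qed
    have "measure (distr \<mu> borel exp_neg) C = measure (distr \<nu> borel exp_neg) C"
      using main[OF \<open>prob_space \<mu>\<close> sets_\<mu>\<nu>(1)] main[OF \<open>prob_space \<nu>\<close> sets_\<mu>\<nu>(2)]
      unfolding cont[OF f_cont] by (rule LIMSEQ_unique)
    moreover have "finite_measure (distr \<mu> borel exp_neg)" "finite_measure (distr \<nu> borel exp_neg)"
      by (simp_all add: \<mu>.finite_measure_distr \<nu>.finite_measure_distr)
    ultimately show ?thesis
      by (simp add: finite_measure.emeasure_eq_measure)
  qed simp
  have eq: "distr \<mu> borel exp_neg = distr \<nu> borel exp_neg"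
    by (rule measure_eqI_closed) (auto simp: closed_eq \<mu>.finite_measure_distr)
  define L :: "real^'n \<Rightarrow> real^'n" where "L y = (\<chi> j. - ln (y $ j))" for y
  have [measurable]: "L \<in> borel_measurable borel" by (rule borel_measurable_vec_componentwise) (simp add: L_def)
  have L: "L (exp_neg x) = x" for x by (simp add: L_def exp_neg_def vec_eq_iff)
  have "distr (distr \<rho> borel exp_neg) borel L = \<rho>" if "sets \<rho> = sets borel" for \<rho>
  proof -
    have [measurable_cong]: "sets \<rho> = sets borel" by fact
    have "distr (distr \<rho> borel exp_neg) borel L = distr \<rho> borel (\<lambda>x. x)"
      by (subst distr_distr) (auto simp: comp_def L)
    then show ?thesis using distr_id2[of borel \<rho>] that by simp
  qed
  with eq sets_\<mu>\<nu> show ?thesis by metis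
qed

section \<open>Substochastic matrices and sub-intensity matrices\<close>

text \<open>The iterates of the vector of ones decrease, and their limit is a fixed vector of \<open>B\<close>.\<close>
lemma substochastic_iterates_vanish:
  fixes B :: "real^'p^'p"
  assumes nonneg: "\<And>i j. 0 \<le> B $ i $ j" and row: "\<And>i. (\<Sum>j\<in>UNIV. B $ i $ j) \<le> 1"
    and fixed: "\<And>x. B *v x = x \<Longrightarrow> x = 0"
  shows "(\<lambda>K. ((\<lambda>x. B *v x) ^^ K) (\<chi> i. 1) $ i) \<longlonglongrightarrow> 0"
proof -
  define r where "r K = ((\<lambda>x. B *v x) ^^ K) (\<chi> i. 1)" for K
  have r_Suc: "r (Suc K) $ i = (\<Sum>j\<in>UNIV. B $ i $ j * r K $ j)" for K i
    by (simp add: r_def matrix_vector_mult_def)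
  have r_nonneg: "0 \<le> r K $ i" for K i
    by (induction K arbitrary: i) (auto simp: r_Suc intro!: sum_nonneg mult_nonneg_nonneg nonneg, simp add: r_def)
  have r_dec: "r (Suc K) $ i \<le> r K $ i" for K i
  proof (induction K arbitrary: i)
    case 0
    have "r 0 = (\<chi> i. 1)" by (simp add: r_def)
    then show ?case using row[of i] by (simp add: r_Suc)
  next
    case (Suc K)
    then show ?case unfolding r_Suc[of "Suc K"] r_Suc[of K] by (intro sum_mono mult_left_mono nonneg)
  qed
  have "\<exists>z. (\<lambda>K. r K $ i) \<longlonglongrightarrow> z" for i
  proof -
    have "decseq (\<lambda>K. r K $ i)" using r_dec by (simp add: decseq_Suc_iff)
    then show ?thesis by (rule decseq_convergent[of _ 0]) (auto intro: r_nonneg)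
  qed
  then obtain z where z: "\<And>i. (\<lambda>K. r K $ i) \<longlonglongrightarrow> z i" by metis
  have "B *v (\<chi> i. z i) = (\<chi> i. z i)"
  proof (rule vec_eq_iff[THEN iffD2], intro allI)
    fix i
    have "(\<lambda>K. r (Suc K) $ i) \<longlonglongrightarrow> (\<Sum>j\<in>UNIV. B $ i $ j * z j)"
      unfolding r_Suc by (intro tendsto_intros z)
    moreover have "(\<lambda>K. r (Suc K) $ i) \<longlonglongrightarrow> z i" by (rule LIMSEQ_Suc[OF z])
    ultimately show "(B *v (\<chi> i. z i)) $ i = (\<chi> i. z i) $ i"
      by (simp add: matrix_vector_mult_def LIMSEQ_unique)
  qed
  then have "(\<chi> i. z i) = 0" by (rule fixed)
  then have "z i = 0" by (simp add: vec_eq_iff)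
  with z[of i] show ?thesis by (simp add: r_def)
qed

text \<open>A subsolution stays below its own iterates, and these are dominated by a multiple of the
  iterates of the vector of ones.\<close>
lemma substochastic_subsolution_eq_0:
  fixes B :: "real^'p^'p"
  assumes nonneg: "\<And>i j. 0 \<le> B $ i $ j" and row: "\<And>i. (\<Sum>j\<in>UNIV. B $ i $ j) \<le> 1"
    and fixed: "\<And>x. B *v x = x \<Longrightarrow> x = 0"
    and y: "\<And>i. 0 \<le> y $ i" "\<And>i. y $ i \<le> (B *v y) $ i"
  shows "y = 0"
proof -
  define c where "c = (\<Sum>i\<in>UNIV. y $ i)"
  have bound: "y $ i \<le> c * ((\<lambda>x. B *v x) ^^ K) (\<chi> i. 1) $ i" for K i
  proof (induction K arbitrary: i)
    case 0
    then show ?case using y(1) by (auto simp: c_def intro: member_le_sum)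
  next
    case (Suc K)
    have "y $ i \<le> (\<Sum>j\<in>UNIV. B $ i $ j * y $ j)"
      using y(2)[of i] by (simp add: matrix_vector_mult_def)
    also have "\<dots> \<le> (\<Sum>j\<in>UNIV. B $ i $ j * (c * ((\<lambda>x. B *v x) ^^ K) (\<chi> i. 1) $ j))"
      by (intro sum_mono mult_left_mono nonneg Suc)
    also have "\<dots> = c * ((\<lambda>x. B *v x) ^^ Suc K) (\<chi> i. 1) $ i"
      by (simp add: matrix_vector_mult_def sum_distrib_left ac_simps)
    finally show ?case .
  qed
  have "y $ i \<le> c * 0" for i
    by (rule LIMSEQ_le_const[OF tendsto_mult_left[OF substochastic_iterates_vanish[OF nonneg row fixed]]])
       (use bound in auto)
  then show ?thesis using y(1) by (simp add: vec_eq_iff order_antisym)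
qed

lemma det_nonzero_iff_ker:
  fixes A :: "real^'p^'p"
  shows "det A \<noteq> 0 \<longleftrightarrow> (\<forall>x. A *v x = 0 \<longrightarrow> x = 0)"
  by (metis invertible_det_nz invertible_left_inverse matrix_left_invertible_ker)

lemma matrix_vector_mult_diag: "(diag_mat c *v x) $ i = c $ i * x $ i"
  by (simp add: diag_mat_def matrix_vector_mult_def if_distrib[of "\<lambda>z. z * _"] cong: if_cong)

text \<open>If \<open>(\<Delta>(c) - T) x = 0\<close>, then the absolute values of the entries of \<open>x\<close> form a subsolution for
  the uniformised matrix \<open>B = I + T / k\<close>, which is substochastic once \<open>k\<close> is at least every \<open>- T $ i $ i\<close>.
  A fixed vector of \<open>B\<close> lies in the kernel of \<open>T\<close>, so invertibility of \<open>T\<close> excludes it.\<close>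
lemma det_diag_minus_sub_intensity_nonzero:
  fixes T :: "real^'p^'p"
  assumes T: "sub_intensity_matrix T" and c: "\<And>i. 0 \<le> c $ i"
  shows "det (diag_mat c - T) \<noteq> 0"
  unfolding det_nonzero_iff_ker
proof (intro allI impI)
  fix x assume x: "(diag_mat c - T) *v x = 0"
  define k where "k = (\<Sum>i\<in>UNIV. - T $ i $ i)"
  have diag: "T $ i $ i < 0" for i using T by (simp add: sub_intensity_matrix_def)
  have k_ge: "- T $ i $ i \<le> k" for i
    unfolding k_def by (rule member_le_sum) (use diag less_imp_le in auto)
  have "0 < k" using diag k_ge less_le_trans neg_0_less_iff_less by blast
  define B :: "real^'p^'p" where "B = (\<chi> i j. (if i = j then 1 else 0) + T $ i $ j / k)"
  have B_mult: "(B *v w) $ i = w $ i + (T *v w) $ i / k" for w i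
    by (simp add: B_def matrix_vector_mult_def distrib_right sum.distrib sum_divide_distrib
        if_distrib[of "\<lambda>z. z * _"] cong: if_cong)
  have nonneg: "0 \<le> B $ i $ j" for i j
  proof (cases "i = j")
    case True then show ?thesis using k_ge[of i] \<open>0 < k\<close> by (auto simp: B_def field_simps)
  next
    case False then show ?thesis using T \<open>0 < k\<close> by (simp add: B_def sub_intensity_matrix_def)
  qed
  have row: "(\<Sum>j\<in>UNIV. B $ i $ j) \<le> 1" for i
  proof -
    have "(\<Sum>j\<in>UNIV. B $ i $ j) = (B *v (\<chi> i. 1)) $ i" by (simp add: matrix_vector_mult_def)
    also have "\<dots> = 1 - exit_rates T $ i / k" by (simp add: B_mult exit_rates_def)
    finally show ?thesis using T \<open>0 < k\<close> by (simp add: sub_intensity_matrix_def)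
  qed
  have fixed: "w = 0" if "B *v w = w" for w
  proof -
    have "T *v w = 0" using that \<open>0 < k\<close> by (simp add: vec_eq_iff B_mult)
    moreover have "invertible T" using T by (simp add: sub_intensity_matrix_def)
    ultimately show ?thesis by (metis invertible_left_inverse matrix_left_invertible_ker)
  qed
  define y where "y = (\<chi> i. \<bar>x $ i\<bar>)"
  have "y $ i \<le> (B *v y) $ i" for i
  proof -
    have "(T *v x) $ i = c $ i * x $ i"
      using x by (simp add: vec_eq_iff matrix_vector_mult_diff_rdistrib matrix_vector_mult_diag)
    then have "(1 + c $ i / k) * x $ i = (B *v x) $ i" by (simp add: B_mult distrib_right)
    then have "(1 + c $ i / k) * \<bar>x $ i\<bar> = \<bar>(B *v x) $ i\<bar>"
      using c[of i] \<open>0 < k\<close> by (metis abs_mult abs_of_nonneg add_nonneg_nonneg divide_nonneg_pos zero_le_one)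
    also have "\<dots> \<le> (B *v y) $ i"
      unfolding matrix_vector_mult_def y_def using nonneg
      by (auto intro!: order_trans[OF sum_abs] sum_mono simp: abs_mult)
    finally have "(1 + c $ i / k) * \<bar>x $ i\<bar> \<le> (B *v y) $ i" .
    moreover have "0 \<le> c $ i / k * \<bar>x $ i\<bar>" using c[of i] \<open>0 < k\<close> by simp
    ultimately show ?thesis by (simp add: y_def distrib_right)
  qed
  then have "y = 0"
    by (intro substochastic_subsolution_eq_0[OF nonneg row fixed]) (auto simp: y_def)
  then show "x = 0" by (simp add: y_def vec_eq_iff)
qed

lemma tendsto_det:
  fixes A :: "'b \<Rightarrow> real^'p^'p"
  assumes "\<And>i j. ((\<lambda>m. A m $ i $ j) \<longlongrightarrow> L $ i $ j) F"
  shows "((\<lambda>m. det (A m)) \<longlongrightarrow> det L) F"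
  unfolding det_def by (intro tendsto_intros assms)

lemma matrix_mul_matrix_inv:
  assumes "invertible A"
  shows "A ** matrix_inv A = mat 1"
  using assms unfolding invertible_def matrix_inv_def by (rule someI2_ex) simp

text \<open>Cramer's rule expresses the solutions by determinants, which are continuous in the entries.\<close>
lemma tendsto_linear_system_solution:
  fixes A :: "'b \<Rightarrow> real^'p^'p"
  assumes A: "\<And>i j. ((\<lambda>m. A m $ i $ j) \<longlongrightarrow> L $ i $ j) F"
    and b: "\<And>i. ((\<lambda>m. b m $ i) \<longlongrightarrow> c $ i) F" and L: "det L \<noteq> 0"
  obtains x where "\<forall>\<^sub>F m in F. A m *v x m = b m"
    and "\<And>i. ((\<lambda>m. x m $ i) \<longlongrightarrow> (matrix_inv L *v c) $ i) F"
proof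
  define x where "x m = (\<chi> k. det (\<chi> i j. if j = k then b m $ i else A m $ i $ j) / det (A m))" for m
  show "\<forall>\<^sub>F m in F. A m *v x m = b m"
    using tendsto_imp_eventually_ne[OF tendsto_det[of A L F, OF A] L]
    by eventually_elim (simp add: x_def cramer)
  have "L *v (matrix_inv L *v c) = c"
    using matrix_mul_matrix_inv[of L] L by (simp add: matrix_vector_mul_assoc invertible_det_nz)
  then have sol: "matrix_inv L *v c = (\<chi> k. det (\<chi> i j. if j = k then c $ i else L $ i $ j) / det L)"
    using cramer[OF L] by blast
  show "((\<lambda>m. x m $ i) \<longlongrightarrow> (matrix_inv L *v c) $ i) F" for i
    unfolding sol x_def vec_lambda_beta
    by (intro tendsto_divide tendsto_det A L) (auto intro: A b)
qed

section \<open>Transition semigroups\<close>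

lemma const_over_Suc_at_right:
  fixes c :: real
  assumes "0 < c"
  shows "filterlim (\<lambda>n. c / real (Suc n)) (at_right 0) sequentially"
proof -
  have "(\<lambda>n. c / real (Suc n)) \<longlonglongrightarrow> 0" by (rule LIMSEQ_Suc[OF lim_const_over_n])
  then show ?thesis unfolding filterlim_at using assms by (simp add: always_eventually)
qed

text \<open>The derivative of the holding probability \<open>p(t) = P t a a\<close> at 0 vanishes, and
  \<open>p(t) \<ge> p(t/n)\<^sup>n \<ge> 1 + n (p(t/n) - 1)\<close> by the semigroup property and Bernoulli's inequality. The
  lower bound tends to 1.\<close>
lemma transition_semigroup_absorbing:
  assumes P: "transition_semigroup Q P" and Q: "Q a a = 0" and "0 \<le> t"
  shows "P t a j = (if j = a then 1 else 0)"
proof -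
  have nn: "0 \<le> P s i j" if "0 \<le> s" for s i j using P that by (simp add: transition_semigroup_def)
  have row: "(\<Sum>j\<in>UNIV. P s i j) = 1" if "0 \<le> s" for s i using P that by (simp add: transition_semigroup_def)
  have mult: "P (s + u) i j = (\<Sum>k\<in>UNIV. P s i k * P u k j)" if "0 \<le> s" "0 \<le> u" for s u i j
    using P that by (simp add: transition_semigroup_def)
  have le1: "P s a a \<le> 1" if "0 \<le> s" for s
    using member_le_sum[of a UNIV "\<lambda>j. P s a j"] nn[OF that] row[OF that] by simp
  have pow: "P s a a ^ n \<le> P (real n * s) a a" if "0 \<le> s" for s n
  proof (induction n)
    case 0 then show ?case using P by (simp add: transition_semigroup_def)
  next
    case (Suc n)
    have "P s a a ^ Suc n \<le> P s a a * P (real n * s) a a"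
      using Suc nn[OF that] by (simp add: mult_left_mono)
    also have "\<dots> \<le> (\<Sum>k\<in>UNIV. P s a k * P (real n * s) k a)"
      by (rule member_le_sum[of a UNIV "\<lambda>k. P s a k * P (real n * s) k a"]) (use nn that in auto)
    also have "\<dots> = P (real (Suc n) * s) a a"
      using mult[of s "real n * s"] that by (simp add: algebra_simps)
    finally show ?case .
  qed
  have one: "P t a a = 1"
  proof (cases "t = 0")
    case True then show ?thesis using P by (simp add: transition_semigroup_def)
  next
    case False
    with \<open>0 \<le> t\<close> have "0 < t" by simp
    have "((\<lambda>s. (P s a a - P 0 a a) / (s - 0)) \<longlongrightarrow> 0) (at_right 0)"
      using P Q unfolding transition_semigroup_def has_field_derivative_iff by metis
    then have lim: "((\<lambda>s. (P s a a - 1) / s) \<longlongrightarrow> 0) (at_right 0)"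
      using P by (simp add: transition_semigroup_def)
    from filterlim_compose[OF lim const_over_Suc_at_right[OF \<open>0 < t\<close>]]
    have "(\<lambda>n. 1 + t * ((P (t / real (Suc n)) a a - 1) / (t / real (Suc n)))) \<longlonglongrightarrow> 1 + t * 0"
      by (intro tendsto_intros)
    moreover have "1 + t * ((P (t / real (Suc n)) a a - 1) / (t / real (Suc n))) \<le> P t a a" for n
    proof -
      let ?s = "t / real (Suc n)"
      have s: "0 \<le> ?s" using \<open>0 < t\<close> by simp
      have "1 + t * ((P ?s a a - 1) / ?s) = 1 + real (Suc n) * (P ?s a a - 1)"
        using \<open>0 < t\<close> by (simp add: field_simps)
      also have "\<dots> \<le> (1 + (P ?s a a - 1)) ^ Suc n"
        using nn[OF s, of a a] by (intro Bernoulli_inequality) simp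
      also have "\<dots> \<le> P t a a" using pow[OF s, of "Suc n"] by simp
      finally show ?thesis .
    qed
    ultimately have "1 + t * 0 \<le> P t a a" by (meson LIMSEQ_le_const2)
    with le1[OF \<open>0 \<le> t\<close>] show ?thesis by simp
  qed
  have "(\<Sum>j\<in>UNIV - {a}. P t a j) = 0"
    using row[OF \<open>0 \<le> t\<close>, of a] one by (simp add: sum.remove[of UNIV a])
  then have "\<forall>j\<in>UNIV - {a}. P t a j = 0"
    by (subst (asm) sum_nonneg_eq_0_iff) (use nn \<open>0 \<le> t\<close> in auto)
  with one show ?thesis by auto
qed

text \<open>In matrix form, \<open>(I - P\<^sub>h D\<^sub>h) / h\<close> tends to \<open>\<Delta>(c) - Q\<close> as \<open>h\<close> decreases to 0, where \<open>D\<^sub>h\<close> is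
  the diagonal matrix of the discount factors \<open>exp (- h c)\<close>.\<close>
lemma transition_semigroup_discounted_derivative:
  assumes P: "transition_semigroup Q P"
  shows "((\<lambda>h. ((if i = j then 1 else 0) - P h i j * exp (- (h * c))) / h)
    \<longlongrightarrow> (if i = j then c else 0) - Q i j) (at_right 0)"
proof -
  have P0: "P 0 i j = (if i = j then 1 else 0)" and "((\<lambda>t. P t i j) has_real_derivative Q i j) (at_right 0)"
    using P by (auto simp: transition_semigroup_def)
  then have "((\<lambda>h. P h i j * exp (- (h * c))) has_real_derivative
      (Q i j - (if i = j then c else 0))) (at_right 0)"
    by (auto intro!: derivative_eq_intros)
  then have "((\<lambda>h. - ((P h i j * exp (- (h * c)) - P 0 i j) / h)) \<longlongrightarrow> - (Q i j - (if i = j then c else 0))) (at_right 0)"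
    unfolding has_field_derivative_iff by (intro tendsto_minus) simp
  then show ?thesis by (simp add: P0 minus_divide_left)
qed

section \<open>Skeletons of a Markov jump process\<close>

lemma sum_option: "(\<Sum>x\<in>UNIV. f x) = f None + (\<Sum>i\<in>UNIV. f (Some i))" for f :: "'p::finite option \<Rightarrow> real"
  by (simp add: UNIV_option_conv sum.reindex)

text \<open>The transition semigroup, existentially quantified in the definition of a Markov jump process,
  is a parameter here.\<close>
locale jump_process = prob_space N for N :: "'b measure" +
  fixes X :: "real \<Rightarrow> 'b \<Rightarrow> 's::finite" and p0 :: "'s \<Rightarrow> real" and Q P
  assumes X_measurable: "\<And>t. 0 \<le> t \<Longrightarrow> X t \<in> measurable N (count_space UNIV)"
    and right_cont: "\<And>\<omega> t. \<omega> \<in> space N \<Longrightarrow> 0 \<le> t \<Longrightarrow> \<forall>\<^sub>F s in at_right t. X s \<omega> = X t \<omega>"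
    and initial: "\<And>x. measure N {\<omega> \<in> space N. X 0 \<omega> = x} = p0 x"
    and semigroup: "transition_semigroup Q P"
    and fdd: "\<And>n t x. 0 \<le> t 0 \<Longrightarrow> (\<And>k. k \<le> n \<Longrightarrow> t k \<le> t (Suc k)) \<Longrightarrow>
          measure N {\<omega> \<in> space N. \<forall>k\<le>Suc n. X (t k) \<omega> = x k} =
          measure N {\<omega> \<in> space N. \<forall>k\<le>n. X (t k) \<omega> = x k} *
            P (t (Suc n) - t n) (x n) (x (Suc n))"

lemma markov_jump_process_imp_jump_process:
  fixes X :: "real \<Rightarrow> 'b \<Rightarrow> 's::finite"
  assumes "markov_jump_process N X p0 Q"
  obtains P where "jump_process N X p0 Q P"
proof -
  from assms obtain P where P: "transition_semigroup Q P"
    "\<forall>(n::nat) (t::nat \<Rightarrow> real) (x::nat \<Rightarrow> 's).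
          0 \<le> t 0 \<and> (\<forall>k\<le>n. t k \<le> t (Suc k)) \<longrightarrow>
          measure N {\<omega> \<in> space N. \<forall>k\<le>Suc n. X (t k) \<omega> = x k} =
          measure N {\<omega> \<in> space N. \<forall>k\<le>n. X (t k) \<omega> = x k} *
            P (t (Suc n) - t n) (x n) (x (Suc n))"
    unfolding markov_jump_process_def by (elim conjE exE)
  have "jump_process N X p0 Q P"
    unfolding jump_process_def jump_process_axioms_def
    using assms P unfolding markov_jump_process_def by simp
  then show thesis by (rule that)
qed

context jump_process
begin

lemma X_in_sets [measurable]: "0 \<le> t \<Longrightarrow> {\<omega> \<in> space N. X t \<omega> = x} \<in> sets N"
  using measurable_sets[OF X_measurable, of t "{x}"] by (simp add: vimage_def Int_def conj_commute)

lemma fX_measurable: "0 \<le> t \<Longrightarrow> (\<lambda>\<omega>. f (X t \<omega>)) \<in> borel_measurable N" for f :: "'s \<Rightarrow> real"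
  by (rule measurable_compose[OF X_measurable]) auto

lemma expectation_sum_indicator:
  assumes "\<And>i. i \<in> I \<Longrightarrow> A i \<in> events"
  shows "expectation (\<lambda>\<omega>. \<Sum>i\<in>I. c i * indicat_real (A i) \<omega>) = (\<Sum>i\<in>I. c i * prob (A i))"
  using assms by (subst Bochner_Integration.integral_sum)
    (auto intro!: integrable_mult_right integrable_real_indicator simp del: integrable_mult_right_iff
      simp: emeasure_eq_measure)

text \<open>The Markov property for functions of the past: a function of the first \<open>n + 1\<close> states is a
  finite linear combination of indicators of paths, and for these the claim is the formula for the
  finite-dimensional distributions.\<close>
lemma expectation_one_step:
  fixes \<Phi> :: "(nat \<Rightarrow> 's) \<Rightarrow> real" and f :: "'s \<Rightarrow> real"
  assumes t: "0 \<le> t 0" "\<And>k. k \<le> n \<Longrightarrow> t k \<le> t (Suc k)"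
  shows "expectation (\<lambda>\<omega>. \<Phi> (\<lambda>k\<in>{..n}. X (t k) \<omega>) * f (X (t (Suc n)) \<omega>)) =
    expectation (\<lambda>\<omega>. \<Phi> (\<lambda>k\<in>{..n}. X (t k) \<omega>) * (\<Sum>j\<in>UNIV. P (t (Suc n) - t n) (X (t n) \<omega>) j * f j))"
proof -
  define Y where "Y = PiE {..n} (\<lambda>_. UNIV :: 's set)"
  have "finite Y" by (simp add: Y_def finite_PiE)
  define A where "A y = {\<omega> \<in> space N. \<forall>k\<le>n. X (t k) \<omega> = y k}" for y
  define A' where "A' y j = {\<omega> \<in> space N. \<forall>k\<le>Suc n. X (t k) \<omega> = (y(Suc n := j)) k}" for y j
  have t_nonneg: "0 \<le> t k" if "k \<le> Suc n" for k
    using that t by (induction k) (auto intro: order_trans)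
  have [measurable]: "A y \<in> sets N" for y
  proof -
    have "A y = space N \<inter> (\<Inter>k\<in>{..n}. {\<omega> \<in> space N. X (t k) \<omega> = y k})" by (auto simp: A_def)
    then show ?thesis using t_nonneg by (auto intro!: sets.Int sets.finite_INT)
  qed
  have A'_eq: "A' y j = A y \<inter> {\<omega> \<in> space N. X (t (Suc n)) \<omega> = j}" for y j
    by (auto simp: A_def A'_def le_Suc_eq)
  then have [measurable]: "A' y j \<in> sets N" for y j using t_nonneg[of "Suc n"] by auto
  have A'_prob: "prob (A' y j) = prob (A y) * P (t (Suc n) - t n) (y n) j" for y j
  proof -
    have "A y = {\<omega> \<in> space N. \<forall>k\<le>n. X (t k) \<omega> = (y(Suc n := j)) k}" by (auto simp: A_def)
    then show ?thesis using fdd[of t n "y(Suc n := j)", OF t] by (simp add: A'_def)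
  qed
  have ind: "indicat_real (A y) \<omega> = (if y = (\<lambda>k\<in>{..n}. X (t k) \<omega>) then 1 else 0)"
    if "y \<in> Y" "\<omega> \<in> space N" for y \<omega>
  proof -
    have "y = (\<lambda>k\<in>{..n}. X (t k) \<omega>) \<longleftrightarrow> \<omega> \<in> A y"
      using that by (force simp: Y_def A_def PiE_def extensional_def restrict_def fun_eq_iff)
    then show ?thesis by (simp add: indicator_def)
  qed
  have path: "(\<lambda>k\<in>{..n}. X (t k) \<omega>) \<in> Y" for \<omega> by (simp add: Y_def)
  have expand: "\<Psi> (\<lambda>k\<in>{..n}. X (t k) \<omega>) = (\<Sum>y\<in>Y. \<Psi> y * indicat_real (A y) \<omega>)"
    if "\<omega> \<in> space N" for \<Psi> :: "(nat \<Rightarrow> 's) \<Rightarrow> real" and \<omega>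
    using that path[of \<omega>] \<open>finite Y\<close> by (simp add: ind if_distrib[of "\<lambda>z. _ * z"] cong: sum.cong if_cong)
  have "expectation (\<lambda>\<omega>. \<Phi> (\<lambda>k\<in>{..n}. X (t k) \<omega>) * f (X (t (Suc n)) \<omega>)) =
    expectation (\<lambda>\<omega>. \<Sum>y\<in>Y. \<Sum>j\<in>UNIV. (\<Phi> y * f j) * indicat_real (A' y j) \<omega>)"
  proof (rule Bochner_Integration.integral_cong[OF refl])
    fix \<omega> assume \<omega>: "\<omega> \<in> space N"
    have f: "f (X (t (Suc n)) \<omega>) = (\<Sum>j\<in>UNIV. f j * indicat_real {\<omega> \<in> space N. X (t (Suc n)) \<omega> = j} \<omega>)"
      using \<omega> by (simp add: indicator_def if_distrib[of "\<lambda>z. _ * z"] cong: if_cong)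
    show "\<Phi> (\<lambda>k\<in>{..n}. X (t k) \<omega>) * f (X (t (Suc n)) \<omega>) =
        (\<Sum>y\<in>Y. \<Sum>j\<in>UNIV. (\<Phi> y * f j) * indicat_real (A' y j) \<omega>)"
      unfolding f expand[OF \<omega>, of \<Phi>] sum_product A'_eq by (simp add: indicator_inter_arith ac_simps)
  qed
  also have "\<dots> = (\<Sum>y\<in>Y. \<Sum>j\<in>UNIV. (\<Phi> y * f j) * prob (A' y j))"
    unfolding sum.cartesian_product split_def by (rule expectation_sum_indicator) auto
  also have "\<dots> = (\<Sum>y\<in>Y. (\<Phi> y * (\<Sum>j\<in>UNIV. P (t (Suc n) - t n) (y n) j * f j)) * prob (A y))"
    by (simp add: A'_prob sum_distrib_left sum_distrib_right ac_simps)
  also have "\<dots> = expectation (\<lambda>\<omega>. \<Sum>y\<in>Y. (\<Phi> y * (\<Sum>j\<in>UNIV. P (t (Suc n) - t n) (y n) j * f j)) * indicat_real (A y) \<omega>)"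
    by (subst expectation_sum_indicator) auto
  also have "\<dots> = expectation (\<lambda>\<omega>. \<Phi> (\<lambda>k\<in>{..n}. X (t k) \<omega>) * (\<Sum>j\<in>UNIV. P (t (Suc n) - t n) (X (t n) \<omega>) j * f j))"
  proof (rule Bochner_Integration.integral_cong[OF refl])
    fix \<omega> assume \<omega>: "\<omega> \<in> space N"
    show "(\<Sum>y\<in>Y. (\<Phi> y * (\<Sum>j\<in>UNIV. P (t (Suc n) - t n) (y n) j * f j)) * indicat_real (A y) \<omega>) =
      \<Phi> (\<lambda>k\<in>{..n}. X (t k) \<omega>) * (\<Sum>j\<in>UNIV. P (t (Suc n) - t n) (X (t n) \<omega>) j * f j)"
      using expand[OF \<omega>, of "\<lambda>y. \<Phi> y * (\<Sum>j\<in>UNIV. P (t (Suc n) - t n) (y n) j * f j)"] by simp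
  qed
  finally show ?thesis .
qed

lemma expectation_initial: "expectation (\<lambda>\<omega>. f (X 0 \<omega>)) = (\<Sum>x\<in>UNIV. p0 x * f x)"
proof -
  have "expectation (\<lambda>\<omega>. f (X 0 \<omega>)) = expectation (\<lambda>\<omega>. \<Sum>x\<in>UNIV. f x * indicat_real {\<omega> \<in> space N. X 0 \<omega> = x} \<omega>)"
    by (intro Bochner_Integration.integral_cong) (auto simp: indicator_def if_distrib[of "\<lambda>z. _ * z"] cong: if_cong)
  also have "\<dots> = (\<Sum>x\<in>UNIV. p0 x * f x)"
    by (subst expectation_sum_indicator) (auto simp: initial mult.commute)
  finally show ?thesis .
qed

lemma expectation_at:
  assumes "0 \<le> t"
  shows "expectation (\<lambda>\<omega>. f (X t \<omega>)) = (\<Sum>x\<in>UNIV. p0 x * (\<Sum>j\<in>UNIV. P t x j * f j))"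
  using expectation_one_step[where \<Phi> = "\<lambda>_. 1" and n = 0 and t = "\<lambda>k. if k = 0 then 0 else t" and f = f] assms
  by (simp add: expectation_initial[where f = "\<lambda>x. \<Sum>j\<in>UNIV. P t x j * f j"])

text \<open>The hypothesis says that \<open>v\<close> is harmonic for the skeleton discounted by the factor \<open>d\<close> at each
  state visited after time 0, so the discounted values of \<open>v\<close> along the skeleton have constant expectation.\<close>
lemma expectation_discounted_skeleton:
  assumes "0 \<le> h" and v: "\<And>i. v i = (\<Sum>j\<in>UNIV. P h i j * (d j * v j))"
  shows "expectation (\<lambda>\<omega>. (\<Prod>k=1..K. d (X (real k * h) \<omega>)) * v (X (real K * h) \<omega>)) =
    (\<Sum>x\<in>UNIV. p0 x * v x)"
proof (induction K)
  case 0 then show ?case by (simp add: expectation_initial)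
next
  case (Suc K)
  have "expectation (\<lambda>\<omega>. (\<Prod>k=1..Suc K. d (X (real k * h) \<omega>)) * v (X (real (Suc K) * h) \<omega>)) =
    expectation (\<lambda>\<omega>. (\<lambda>y. \<Prod>k=1..K. d (y k)) (\<lambda>k\<in>{..K}. X (real k * h) \<omega>) *
       (d (X (real (Suc K) * h) \<omega>) * v (X (real (Suc K) * h) \<omega>)))"
    by (simp add: prod.cl_ivl_Suc mult.assoc cong: prod.cong_simp)
  also have "\<dots> = expectation (\<lambda>\<omega>. (\<lambda>y. \<Prod>k=1..K. d (y k)) (\<lambda>k\<in>{..K}. X (real k * h) \<omega>) *
       (\<Sum>j\<in>UNIV. P (real (Suc K) * h - real K * h) (X (real K * h) \<omega>) j * (d j * v j)))"
    by (rule expectation_one_step[where f = "\<lambda>j. d j * v j"]) (use \<open>0 \<le> h\<close> in \<open>auto intro: mult_right_mono\<close>)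
  also have "real (Suc K) * h - real K * h = h" by (simp add: algebra_simps)
  also have "expectation (\<lambda>\<omega>. (\<lambda>y. \<Prod>k=1..K. d (y k)) (\<lambda>k\<in>{..K}. X (real k * h) \<omega>) *
       (\<Sum>j\<in>UNIV. P h (X (real K * h) \<omega>) j * (d j * v j))) =
    expectation (\<lambda>\<omega>. (\<Prod>k=1..K. d (X (real k * h) \<omega>)) * v (X (real K * h) \<omega>))"
    by (simp add: v[symmetric] cong: prod.cong_simp)
  also note Suc
  finally show ?case .
qed

text \<open>For two fixed times this follows from \<open>transition_semigroup_absorbing\<close>. It then holds for all
  rational times simultaneously, and right-continuity of the paths extends it to all real times.\<close>
lemma AE_absorbing_state:
  assumes Q: "Q a a = 0"
  shows "AE \<omega> in N. \<forall>s t. 0 \<le> s \<longrightarrow> s \<le> t \<longrightarrow> X s \<omega> = a \<longrightarrow> X t \<omega> = a"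
proof -
  have two: "AE \<omega> in N. X s \<omega> = a \<longrightarrow> X t \<omega> = a" if "0 \<le> s" "s \<le> t" for s t
  proof -
    have "AE \<omega> in N. \<not> (X s \<omega> = a \<and> X t \<omega> = j)" if "j \<noteq> a" for j
    proof -
      have "{\<omega> \<in> space N. X s \<omega> = a \<and> X t \<omega> = j} = {\<omega> \<in> space N. X s \<omega> = a} \<inter> {\<omega> \<in> space N. X t \<omega> = j}"
        by auto
      then have S: "{\<omega> \<in> space N. X s \<omega> = a \<and> X t \<omega> = j} \<in> sets N"
        using \<open>0 \<le> s\<close> \<open>s \<le> t\<close> by auto
      have "{\<omega> \<in> space N. X s \<omega> = a \<and> X t \<omega> = j} =
         {\<omega> \<in> space N. \<forall>k\<le>Suc 0. X (if k = 0 then s else t) \<omega> = (if k = 0 then a else j)}"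
        by (auto simp: le_Suc_eq)
      then have "prob {\<omega> \<in> space N. X s \<omega> = a \<and> X t \<omega> = j} = 0"
        using fdd[of "\<lambda>k. if k = 0 then s else t" 0 "\<lambda>k. if k = 0 then a else j"] \<open>0 \<le> s\<close> \<open>s \<le> t\<close> \<open>j \<noteq> a\<close>
          transition_semigroup_absorbing[OF semigroup Q, of "t - s" j] by simp
      then show ?thesis using S by (simp add: AE_iff_measurable[OF S] emeasure_eq_measure)
    qed
    then have "AE \<omega> in N. \<forall>j\<in>UNIV - {a}. \<not> (X s \<omega> = a \<and> X t \<omega> = j)"
      by (intro AE_finite_allI) auto
    then show ?thesis by eventually_elim auto
  qed
  have "AE \<omega> in N. \<forall>s\<in>\<rat>. \<forall>t\<in>\<rat>. 0 \<le> s \<longrightarrow> s \<le> t \<longrightarrow> X s \<omega> = a \<longrightarrow> X t \<omega> = a"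
    by (subst AE_ball_countable, simp add: countable_rat, intro ballI, subst AE_ball_countable, simp add: countable_rat)
       (use two in auto)
  with AE_space show ?thesis
  proof eventually_elim
    case (elim \<omega>)
    show ?case
    proof (intro allI impI)
      fix s t :: real assume st: "0 \<le> s" "s \<le> t" "X s \<omega> = a"
      show "X t \<omega> = a"
      proof (cases "s = t")
        case False
        with st have "s < t" "0 \<le> t" by auto
        obtain b where b: "s < b" "\<forall>r>s. r < b \<longrightarrow> X r \<omega> = X s \<omega>"
          using right_cont[OF elim(1) st(1)] unfolding eventually_at_right_field by (elim exE conjE)
        obtain c where c: "t < c" "\<forall>r>t. r < c \<longrightarrow> X r \<omega> = X t \<omega>"
          using right_cont[OF elim(1) \<open>0 \<le> t\<close>] unfolding eventually_at_right_field by (elim exE conjE)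
        obtain q where q: "q \<in> \<rat>" "s < q" "q < min b t"
          using Rats_dense_in_real[of s "min b t"] b(1) \<open>s < t\<close> by auto
        obtain r where r: "r \<in> \<rat>" "t < r" "r < c" using Rats_dense_in_real[OF c(1)] by auto
        have "X q \<omega> = a" using b(2)[rule_format, of q] q st by auto
        then have "X r \<omega> = a" using elim(2)[rule_format, OF q(1) r(1)] q r st by simp
        then show ?thesis using c(2)[rule_format, of r] r by auto
      qed (use st in simp)
    qed
  qed
qed

end

section \<open>Riemann sums of right-continuous step functions\<close>

text \<open>The first point to the right of \<open>t\<close>, and different from \<open>t\<close>, of the grid of mesh \<open>1 / Suc m\<close>.
  Approximating strictly from the right makes right-continuity sufficient at every point, jump times
  included.\<close>
definition right_grid :: "nat \<Rightarrow> real \<Rightarrow> real" where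
  "right_grid m t = (real (nat \<lfloor>t * real (Suc m)\<rfloor>) + 1) / real (Suc m)"

lemma right_grid_bounds:
  assumes "0 \<le> t"
  shows "t < right_grid m t" "right_grid m t \<le> t + 1 / real (Suc m)"
proof -
  have *: "real (nat \<lfloor>t * real (Suc m)\<rfloor>) = of_int \<lfloor>t * real (Suc m)\<rfloor>" using assms by simp
  show "t < right_grid m t"
    unfolding right_grid_def * using real_of_int_floor_add_one_gt[of "t * real (Suc m)"]
    by (subst pos_less_divide_eq) (simp_all del: of_nat_Suc)
  show "right_grid m t \<le> t + 1 / real (Suc m)"
    unfolding right_grid_def * by (subst pos_divide_le_eq) (auto simp: distrib_right)
qed

lemma filterlim_right_grid:
  assumes "0 \<le> t"
  shows "filterlim (\<lambda>m. right_grid m t) (at_right t) sequentially"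
proof -
  have "(\<lambda>m. t + 1 / real (Suc m)) \<longlonglongrightarrow> t"
    using tendsto_add[OF tendsto_const LIMSEQ_Suc[OF lim_const_over_n[of 1]], of t] by simp
  then have "(\<lambda>m. right_grid m t) \<longlonglongrightarrow> t"
  proof (rule tendsto_sandwich[rotated 3, OF _ always_eventually always_eventually tendsto_const])
    show "\<forall>m. t \<le> right_grid m t" using right_grid_bounds(1)[OF assms] less_imp_le by blast
    show "\<forall>m. right_grid m t \<le> t + 1 / real (Suc m)" using right_grid_bounds(2)[OF assms] by blast
  qed
  then show ?thesis
    unfolding filterlim_at using right_grid_bounds(1)[OF assms] by (simp add: less_imp_neq[symmetric])
qed

lemma right_grid_eq_iff:
  assumes "1 \<le> k" "0 \<le> t"
  shows "t \<in> {(real k - 1) / real (Suc m)..<real k / real (Suc m)} \<longleftrightarrow> k = nat \<lfloor>t * real (Suc m)\<rfloor> + 1"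
proof -
  have "t \<in> {(real k - 1) / real (Suc m)..<real k / real (Suc m)} \<longleftrightarrow>
      of_int (int k - 1) \<le> t * real (Suc m) \<and> t * real (Suc m) < of_int (int k - 1) + 1"
    by (auto simp: pos_divide_le_eq pos_less_divide_eq simp del: of_nat_Suc)
  also have "\<dots> \<longleftrightarrow> \<lfloor>t * real (Suc m)\<rfloor> = int k - 1"
    by (subst floor_eq_iff) simp
  also have "\<dots> \<longleftrightarrow> k = nat \<lfloor>t * real (Suc m)\<rfloor> + 1"
    using assms by (auto simp: nat_eq_iff)
  finally show ?thesis .
qed

text \<open>The grid cells with index up to \<open>(Suc m)\<^sup>2\<close> cover the interval from 0 to \<open>Suc m\<close>, so that
  refinement of the mesh and growth of the time horizon happen in the same limit.\<close>
lemma riemann_sum_eq_step_function: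
  fixes f :: "real \<Rightarrow> real"
  shows "(\<Sum>k=1..(Suc m)^2. f (real k / real (Suc m)) * indicat_real {(real k - 1) / real (Suc m)..<real k / real (Suc m)} t)
    = (if 0 \<le> t \<and> t < real (Suc m) then f (right_grid m t) else 0)"
proof (cases "0 \<le> t")
  case False
  then have "t \<notin> {(real k - 1) / real (Suc m)..<real k / real (Suc m)}" if "1 \<le> k" for k
  proof -
    have "0 \<le> (real k - 1) / real (Suc m)" using that by simp
    then show ?thesis using False by auto
  qed
  then show ?thesis using False by (auto intro!: sum.neutral simp del: of_nat_Suc)
next
  case True
  define \<kappa> where "\<kappa> = nat \<lfloor>t * real (Suc m)\<rfloor> + 1"
  have "(\<Sum>k=1..(Suc m)^2. f (real k / real (Suc m)) * indicat_real {(real k - 1) / real (Suc m)..<real k / real (Suc m)} t)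
    = (\<Sum>k=1..(Suc m)^2. if k = \<kappa> then f (real \<kappa> / real (Suc m)) else 0)"
    by (intro sum.cong) (use True right_grid_eq_iff[of _ t m] in \<open>auto simp: \<kappa>_def indicator_def\<close>)
  also have "\<dots> = (if \<kappa> \<in> {1..(Suc m)^2} then f (real \<kappa> / real (Suc m)) else 0)" by simp
  also have "real \<kappa> / real (Suc m) = right_grid m t" by (simp add: \<kappa>_def right_grid_def)
  also have "\<kappa> \<in> {1..(Suc m)^2} \<longleftrightarrow> t < real (Suc m)"
  proof -
    have "\<kappa> \<in> {1..(Suc m)^2} \<longleftrightarrow> \<lfloor>t * real (Suc m)\<rfloor> < int ((Suc m)^2)"
      using True by (auto simp: \<kappa>_def nat_less_iff Suc_le_eq simp del: of_nat_power of_nat_Suc)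
    also have "\<dots> \<longleftrightarrow> t * real (Suc m) < real (Suc m) * real (Suc m)"
      by (subst floor_less_iff) (simp only: of_int_of_nat_eq power2_eq_square of_nat_mult of_int_mult)
    also have "\<dots> \<longleftrightarrow> t < real (Suc m)" by (simp only: mult_less_cancel_right_pos of_nat_0_less_iff zero_less_Suc)
    finally show ?thesis .
  qed
  finally show ?thesis using True by simp
qed

text \<open>The Riemann sums are integrals of the functions \<open>f (right_grid m t)\<close> over \<open>{0..<Suc m}\<close>, which
  by right-continuity are eventually equal to \<open>f t\<close> for each \<open>t \<ge> 0\<close>. The bounds on \<open>f\<close> dominate them. The indicator of the
  half-line removes the arbitrary values of \<open>f\<close> at negative times.\<close>
lemma riemann_sums_of_right_continuous_step_function:
  fixes f :: "real \<Rightarrow> real"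
  assumes rc: "\<And>t. 0 \<le> t \<Longrightarrow> \<forall>\<^sub>F s in at_right t. f s = f t"
    and bound: "\<And>t. \<bar>f t\<bar> \<le> C" and zero: "\<And>t. b \<le> t \<Longrightarrow> f t = 0"
  shows "(\<lambda>m. (\<Sum>k=1..(Suc m)^2. f (real k / real (Suc m))) / real (Suc m)) \<longlonglongrightarrow>
      (\<integral>t. indicat_real {0..} t * f t \<partial>lborel)"
    and "(\<lambda>t. indicat_real {0..} t * f t) \<in> borel_measurable borel"
proof -
  define s where "s m t = (\<Sum>k=1..(Suc m)^2. f (real k / real (Suc m)) *
    indicat_real {(real k - 1) / real (Suc m)..<real k / real (Suc m)} t)" for m t
  have s_eq: "s m t = (if 0 \<le> t \<and> t < real (Suc m) then f (right_grid m t) else 0)" for m t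
    unfolding s_def by (rule riemann_sum_eq_step_function)
  have [measurable]: "s m \<in> borel_measurable borel" for m unfolding s_def by measurable
  have lim: "(\<lambda>m. s m t) \<longlonglongrightarrow> indicat_real {0..} t * f t" for t
  proof (cases "0 \<le> t")
    case True
    have "\<forall>\<^sub>F m in sequentially. f (right_grid m t) = f t"
      using rc[OF True] filterlim_right_grid[OF True] by (auto simp: filterlim_iff)
    moreover have "\<forall>\<^sub>F m in sequentially. t < real (Suc m)"
    proof -
      obtain n :: nat where "t < real n" using reals_Archimedean2 by blast
      then show ?thesis by (auto simp: eventually_sequentially intro!: exI[of _ n])
    qed
    ultimately have "\<forall>\<^sub>F m in sequentially. s m t = indicat_real {0..} t * f t"
      by eventually_elim (use True in \<open>simp add: s_eq\<close>)
    then show ?thesis by (rule tendsto_eventually)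
  qed (simp add: s_eq)
  show meas: "(\<lambda>t. indicat_real {0..} t * f t) \<in> borel_measurable borel"
    by (rule borel_measurable_LIMSEQ_real[OF lim]) simp
  have int: "(\<integral>t. s m t \<partial>lborel) = (\<Sum>k=1..(Suc m)^2. f (real k / real (Suc m))) / real (Suc m)" for m
  proof -
    have "(\<integral>t. s m t \<partial>lborel) = (\<Sum>k=1..(Suc m)^2. f (real k / real (Suc m)) *
       measure lborel {(real k - 1) / real (Suc m)..<real k / real (Suc m)})"
      unfolding s_def by (subst Bochner_Integration.integral_sum)
        (auto intro!: integrable_mult_right integrable_real_indicator simp del: integrable_mult_right_iff simp: divide_right_mono)
    also have "\<dots> = (\<Sum>k=1..(Suc m)^2. f (real k / real (Suc m)) * (1 / real (Suc m)))"
      by (intro sum.cong refl) (simp add: divide_right_mono diff_divide_distrib[symmetric])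
    finally show ?thesis by (simp add: sum_divide_distrib)
  qed
  have "(\<lambda>m. \<integral>t. s m t \<partial>lborel) \<longlonglongrightarrow> (\<integral>t. indicat_real {0..} t * f t \<partial>lborel)"
  proof (rule integral_dominated_convergence[where w = "\<lambda>t. C * indicat_real {0..max b 0} t"])
    show "integrable lborel (\<lambda>t. C * indicat_real {0..max b 0} t)"
      by (auto intro!: integrable_mult_right integrable_real_indicator simp del: integrable_mult_right_iff)
    show "AE t in lborel. norm (s m t) \<le> C * indicat_real {0..max b 0} t" for m
    proof (rule AE_I2)
      fix t
      have "0 \<le> C" using bound[of 0] by linarith
      show "norm (s m t) \<le> C * indicat_real {0..max b 0} t"
      proof (cases "0 \<le> t \<and> t \<le> max b 0")
        case True then show ?thesis using bound \<open>0 \<le> C\<close> by (simp add: s_eq)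
      next
        case False
        then have "f (right_grid m t) = 0" if "0 \<le> t"
          using that right_grid_bounds(1)[OF that, of m] by (intro zero) auto
        then show ?thesis using False \<open>0 \<le> C\<close> by (simp add: s_eq)
      qed
    qed
  qed (use lim meas in auto)
  then show "(\<lambda>m. (\<Sum>k=1..(Suc m)^2. f (real k / real (Suc m))) / real (Suc m)) \<longlonglongrightarrow>
      (\<integral>t. indicat_real {0..} t * f t \<partial>lborel)" by (simp only: int)
qed

section \<open>Laplace transform of the sojourn times of an absorbing process\<close>

locale absorbing_jump_process = jump_process N X "transient_initial \<pi>" "absorbing_intensity T" P
  for N :: "'b measure" and X :: "real \<Rightarrow> 'b \<Rightarrow> 'p::finite option" and \<pi> :: "real^'p" and T P +
  assumes sub_intensity: "sub_intensity_matrix T"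
begin

text \<open>The matrix \<open>(I - P\<^sub>h D\<^sub>h) / h\<close> for the mesh \<open>h = 1 / Suc m\<close>.\<close>
definition skeleton_matrix :: "real^'p \<Rightarrow> nat \<Rightarrow> real^'p^'p" where
  "skeleton_matrix \<theta> m = (\<chi> i j. ((if i = j then 1 else 0) -
     P (1 / real (Suc m)) (Some i) (Some j) * exp (- (1 / real (Suc m) * \<theta> $ j))) / (1 / real (Suc m)))"

lemma skeleton_matrix_tendsto:
  "(\<lambda>m. skeleton_matrix \<theta> m $ i $ j) \<longlonglongrightarrow> (diag_mat \<theta> - T) $ i $ j"
proof -
  have "(\<lambda>m. ((if Some i = Some j then 1 else 0) - P (1 / real (Suc m)) (Some i) (Some j) *
      exp (- (1 / real (Suc m) * \<theta> $ j))) / (1 / real (Suc m)))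
    \<longlonglongrightarrow> (if Some i = Some j then \<theta> $ j else 0) - absorbing_intensity T (Some i) (Some j)"
    by (rule filterlim_compose[OF transition_semigroup_discounted_derivative[OF semigroup] const_over_Suc_at_right]) simp
  then show ?thesis by (cases "i = j") (simp_all add: skeleton_matrix_def diag_mat_def)
qed

lemma exit_probability_tendsto:
  "(\<lambda>m. P (1 / real (Suc m)) (Some i) None / (1 / real (Suc m))) \<longlonglongrightarrow> exit_rates T $ i"
proof -
  have "(\<lambda>m. ((if Some i = None then 1 else 0) - P (1 / real (Suc m)) (Some i) None *
      exp (- (1 / real (Suc m) * 0))) / (1 / real (Suc m)))
    \<longlonglongrightarrow> (if Some i = None then 0 else 0) - absorbing_intensity T (Some i) None"
    by (rule filterlim_compose[OF transition_semigroup_discounted_derivative[OF semigroup] const_over_Suc_at_right]) simp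
  from tendsto_minus[OF this] show ?thesis by simp
qed

lemma None_absorbing: "0 \<le> t \<Longrightarrow> P t None j = (if j = None then 1 else 0)"
  by (rule transition_semigroup_absorbing[OF semigroup]) simp_all

lemma P_nonneg: "0 \<le> t \<Longrightarrow> 0 \<le> P t i j"
  and P_sum: "0 \<le> t \<Longrightarrow> (\<Sum>j\<in>UNIV. P t i j) = 1"
  and P_zero: "P 0 i j = (if i = j then 1 else 0)"
  and P_add: "0 \<le> s \<Longrightarrow> 0 \<le> t \<Longrightarrow> P (s + t) i j = (\<Sum>k\<in>UNIV. P s i k * P t k j)"
  using semigroup by (simp_all add: transition_semigroup_def)

text \<open>For a sufficiently small mesh \<open>h\<close> the matrix \<open>B\<close> of transition probabilities between transient
  states has no nonzero fixed vector, because \<open>(I - B) / h\<close> is close to the invertible matrix \<open>- T\<close>.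
  Hence the probability of survival up to time \<open>K h\<close>, an average of entries of the \<open>K\<close>-th iterate
  of the vector of ones, tends to 0.\<close>
lemma AE_absorption: "AE \<omega> in N. \<exists>t\<ge>0. X t \<omega> = None"
proof -
  have "det (diag_mat 0 - T) \<noteq> 0"
    by (rule det_diag_minus_sub_intensity_nonzero[OF sub_intensity]) simp
  then have "\<forall>\<^sub>F m in sequentially. det (skeleton_matrix 0 m) \<noteq> 0"
    by (rule tendsto_imp_eventually_ne[OF tendsto_det[OF skeleton_matrix_tendsto]])
  then obtain m where m: "det (skeleton_matrix 0 m) \<noteq> 0" by (auto simp: eventually_sequentially)
  define h where "h = 1 / real (Suc m)"
  have "0 < h" by (simp add: h_def)
  define B :: "real^'p^'p" where "B = (\<chi> i j. P h (Some i) (Some j))"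
  have row: "(\<Sum>j\<in>UNIV. B $ i $ j) \<le> 1" for i
    using P_sum[of h "Some i"] P_nonneg[of h "Some i" None] \<open>0 < h\<close> by (simp add: sum_option B_def)
  have fixed: "x = 0" if "B *v x = x" for x
  proof -
    have "skeleton_matrix 0 m $ i $ j = ((if i = j then 1 else 0) - B $ i $ j) / h" for i j
      by (simp add: skeleton_matrix_def B_def h_def)
    then have "(skeleton_matrix 0 m *v x) $ i = (x $ i - (B *v x) $ i) / h" for i
      by (simp add: matrix_vector_mult_def left_diff_distrib
          sum_subtractf diff_divide_distrib sum_divide_distrib if_distrib[of "\<lambda>z. z * _"] if_distrib[of "\<lambda>z. z / _"] cong: if_cong)
    then have "skeleton_matrix 0 m *v x = 0" using that by (simp add: vec_eq_iff)
    then show ?thesis using m by (simp add: det_nonzero_iff_ker)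
  qed
  have iterate: "((\<lambda>x. B *v x) ^^ K) (\<chi> i. 1) $ i = (\<Sum>j\<in>UNIV. P (real K * h) (Some i) (Some j))" for K i
  proof (induction K arbitrary: i)
    case 0 then show ?case by (simp add: P_zero)
  next
    case (Suc K)
    have "P (real (Suc K) * h) (Some i) (Some j) =
        (\<Sum>k\<in>UNIV. B $ i $ k * P (real K * h) (Some k) (Some j))" for j
    proof -
      have "P (real (Suc K) * h) (Some i) (Some j) = P (h + real K * h) (Some i) (Some j)"
        by (simp add: algebra_simps)
      also have "\<dots> = (\<Sum>k\<in>UNIV. P h (Some i) k * P (real K * h) k (Some j))"
        using \<open>0 < h\<close> by (intro P_add) auto
      also have "\<dots> = (\<Sum>k\<in>UNIV. B $ i $ k * P (real K * h) (Some k) (Some j))"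
        using \<open>0 < h\<close> by (simp add: sum_option None_absorbing B_def)
      finally show ?thesis .
    qed
    then have "(\<Sum>j\<in>UNIV. P (real (Suc K) * h) (Some i) (Some j)) =
        (\<Sum>j\<in>UNIV. \<Sum>k\<in>UNIV. B $ i $ k * P (real K * h) (Some k) (Some j))" by simp
    also have "\<dots> = (\<Sum>k\<in>UNIV. B $ i $ k * (\<Sum>j\<in>UNIV. P (real K * h) (Some k) (Some j)))"
      by (subst sum.swap) (simp add: sum_distrib_left)
    also have "\<dots> = (B *v ((\<lambda>x. B *v x) ^^ K) (\<chi> i. 1)) $ i"
      by (subst matrix_vector_mult_def) (simp add: Suc)
    also have "\<dots> = ((\<lambda>x. B *v x) ^^ Suc K) (\<chi> i. 1) $ i" by simp
    finally show ?case ..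
  qed
  \<comment> \<open>Survival probabilities are averages of the iterates over the initial distribution.\<close>
  have survival: "prob {\<omega> \<in> space N. X (real K * h) \<omega> \<noteq> None} =
      (\<Sum>i\<in>UNIV. \<pi> $ i * ((\<lambda>x. B *v x) ^^ K) (\<chi> i. 1) $ i)" for K
  proof -
    have Kh: "0 \<le> real K * h" using \<open>0 < h\<close> by simp
    have S: "{\<omega> \<in> space N. X (real K * h) \<omega> \<noteq> None} \<in> events"
      using sets.compl_sets[OF X_in_sets[OF Kh, of None]] by (simp add: set_diff_eq conj_commute cong: conj_cong)
    have "prob {\<omega> \<in> space N. X (real K * h) \<omega> \<noteq> None} =
        expectation (indicat_real {\<omega> \<in> space N. X (real K * h) \<omega> \<noteq> None})"
      using S by simp
    also have "\<dots> = expectation (\<lambda>\<omega>. (if X (real K * h) \<omega> = None then 0 else 1))"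
      by (intro Bochner_Integration.integral_cong) (auto simp: indicator_def)
    also have "\<dots> = (\<Sum>i\<in>UNIV. \<pi> $ i * (\<Sum>j\<in>UNIV. P (real K * h) (Some i) (Some j)))"
      using expectation_at[OF Kh, of "\<lambda>x. if x = None then 0 else 1"] by (simp add: sum_option)
    finally show ?thesis by (simp add: iterate)
  qed
  have to_0: "(\<lambda>K. prob {\<omega> \<in> space N. X (real K * h) \<omega> \<noteq> None}) \<longlonglongrightarrow> 0"
  proof -
    have "(\<lambda>K. \<Sum>i\<in>UNIV. \<pi> $ i * ((\<lambda>x. B *v x) ^^ K) (\<chi> i. 1) $ i) \<longlonglongrightarrow> (\<Sum>i\<in>UNIV. \<pi> $ i * 0)"
      using \<open>0 < h\<close> row fixed by (intro tendsto_intros substochastic_iterates_vanish) (auto simp: B_def P_nonneg)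
    then show ?thesis unfolding survival by simp
  qed
  define Z where "Z = {\<omega> \<in> space N. \<forall>K. X (real K * h) \<omega> \<noteq> None}"
  have ev: "{\<omega> \<in> space N. X (real K * h) \<omega> \<noteq> None} \<in> events" for K
    using sets.compl_sets[OF X_in_sets[of "real K * h" None]] \<open>0 < h\<close>
    by (simp add: set_diff_eq conj_commute cong: conj_cong)
  have "Z = (\<Inter>K. {\<omega> \<in> space N. X (real K * h) \<omega> \<noteq> None})" by (auto simp: Z_def)
  then have Z: "Z \<in> events" using ev by auto
  have "prob Z \<le> 0"
    by (rule LIMSEQ_le_const[OF to_0]) (use ev in \<open>auto simp: Z_def intro!: finite_measure_mono\<close>)
  then have "emeasure N Z = 0" using measure_nonneg[of N Z] by (simp add: emeasure_eq_measure)
  then have "AE \<omega> in N. \<omega> \<notin> Z" using Z by (intro AE_not_in) auto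
  with AE_space show ?thesis
  proof eventually_elim
    case (elim \<omega>)
    then obtain K where "X (real K * h) \<omega> = None" unfolding Z_def by blast
    then show ?case using \<open>0 < h\<close> by (intro exI[of _ "real K * h"]) simp
  qed
qed

text \<open>By right-continuity the infimum over all times is an infimum over countably many, which
  makes the absorption time measurable.\<close>
lemma absorption_time_eq_INF_rat:
  assumes "\<omega> \<in> space N"
  shows "absorption_time X \<omega> = (INF q\<in>\<rat> \<inter> {0..}. if X q \<omega> = None then ereal q else \<infinity>)"
proof (rule antisym)
  show "absorption_time X \<omega> \<le> (INF q\<in>\<rat> \<inter> {0..}. if X q \<omega> = None then ereal q else \<infinity>)"
    unfolding absorption_time_def by (rule INF_greatest) (auto intro: INF_lower)
  show "(INF q\<in>\<rat> \<inter> {0..}. if X q \<omega> = None then ereal q else \<infinity>) \<le> absorption_time X \<omega>"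
    unfolding absorption_time_def
  proof (rule INF_greatest)
    fix t assume "t \<in> {t. 0 \<le> t \<and> X t \<omega> = None}"
    then have t: "0 \<le> t" "X t \<omega> = None" by auto
    show "(INF q\<in>\<rat> \<inter> {0..}. if X q \<omega> = None then ereal q else \<infinity>) \<le> ereal t"
    proof (rule ereal_le_epsilon2)
      fix e :: real assume "0 < e"
      obtain b where b: "t < b" "\<forall>r>t. r < b \<longrightarrow> X r \<omega> = X t \<omega>"
        using right_cont[OF assms t(1)] unfolding eventually_at_right_field by (elim exE conjE)
      obtain q where q: "q \<in> \<rat>" "t < q" "q < min b (t + e)"
        using Rats_dense_in_real[of t "min b (t + e)"] b(1) \<open>0 < e\<close> by auto
      have "(INF q\<in>\<rat> \<inter> {0..}. if X q \<omega> = None then ereal q else \<infinity>) \<le> (if X q \<omega> = None then ereal q else \<infinity>)"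
        by (rule INF_lower) (use q t in auto)
      also have "\<dots> = ereal q" using b(2)[rule_format, of q] q t by simp
      also have "\<dots> \<le> ereal t + ereal e" using q by simp
      finally show "(INF q\<in>\<rat> \<inter> {0..}. if X q \<omega> = None then ereal q else \<infinity>) \<le> ereal t + ereal e" .
    qed
  qed
qed

lemma absorption_time_measurable [measurable]: "absorption_time X \<in> borel_measurable N"
proof -
  have "(\<lambda>\<omega>. INF q\<in>\<rat> \<inter> {0..}. if X q \<omega> = None then ereal q else \<infinity>) \<in> borel_measurable N"
  proof (rule borel_measurable_INF)
    show "countable (\<rat> \<inter> {0..} :: real set)" by (simp add: countable_rat)
    show "(\<lambda>\<omega>. if X q \<omega> = None then ereal q else \<infinity>) \<in> borel_measurable N" if "q \<in> \<rat> \<inter> {0..}" for q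
      using that by (intro measurable_If X_in_sets) auto
  qed
  then show ?thesis by (subst measurable_cong[OF absorption_time_eq_INF_rat])
qed

text \<open>The state at the next grid point depends on the time only through an integer index, so it is
  jointly measurable, and it is eventually equal to the state itself as the mesh tends to 0.\<close>
lemma state_jointly_measurable:
  "(\<lambda>(\<omega>, t). indicat_real {0..} t * (if X t \<omega> = x then 1 else 0)) \<in> borel_measurable (N \<Otimes>\<^sub>M (lborel :: real measure))"
proof -
  define F where "F m = (\<lambda>(\<omega>, t). indicat_real {0..} t * (if X (right_grid m t) \<omega> = x then 1 else 0))" for m
  have F: "F m \<in> borel_measurable (N \<Otimes>\<^sub>M (lborel :: real measure))" for m
  proof -
    have meas: "(\<lambda>z. nat \<lfloor>snd z * real (Suc m)\<rfloor>) \<in> measurable (N \<Otimes>\<^sub>M (lborel :: real measure)) (count_space UNIV)"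
      by measurable
    have "(\<lambda>z. if X ((real k + 1) / real (Suc m)) (fst z) = x then 1 else 0 :: real) \<in> borel_measurable (N \<Otimes>\<^sub>M (lborel :: real measure))" for k :: nat
      by (rule measurable_compose[OF measurable_fst]) (rule fX_measurable[of _ "\<lambda>y. if y = x then 1 else 0"], simp)
    from measurable_compose_countable[OF this meas]
    have "(\<lambda>z. if X (right_grid m (snd z)) (fst z) = x then 1 else 0 :: real) \<in> borel_measurable (N \<Otimes>\<^sub>M (lborel :: real measure))"
      by (simp add: right_grid_def)
    moreover have "(\<lambda>z. indicat_real {0..} (snd z :: real)) \<in> borel_measurable (N \<Otimes>\<^sub>M (lborel :: real measure))"
      by (intro measurable_compose[OF measurable_snd] borel_measurable_indicator) simp
    ultimately show ?thesis unfolding F_def split_def by (rule borel_measurable_times[rotated])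
  qed
  show ?thesis
  proof (rule borel_measurable_LIMSEQ_real[of _ F])
    fix z assume "z \<in> space (N \<Otimes>\<^sub>M (lborel :: real measure))"
    then obtain \<omega> t where z: "z = (\<omega>, t)" "\<omega> \<in> space N" by (auto simp: space_pair_measure)
    show "(\<lambda>m. F m z) \<longlonglongrightarrow> (case z of (\<omega>, t) \<Rightarrow> indicat_real {0..} t * (if X t \<omega> = x then 1 else 0))"
    proof (cases "0 \<le> t")
      case True
      have "\<forall>\<^sub>F m in sequentially. X (right_grid m t) \<omega> = X t \<omega>"
        using right_cont[OF z(2) True] filterlim_right_grid[OF True] by (auto simp: filterlim_iff)
      then have "\<forall>\<^sub>F m in sequentially. F m z = (case z of (\<omega>, t) \<Rightarrow> indicat_real {0..} t * (if X t \<omega> = x then 1 else 0))"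
        by eventually_elim (simp add: F_def z)
      then show ?thesis by (rule tendsto_eventually)
    qed (simp add: F_def z)
  qed (rule F)
qed

lemma total_reward_nth:
  "total_reward X (mat 1) \<omega> $ k = (\<integral>t. indicat_real {t. 0 < ereal t \<and> ereal t < absorption_time X \<omega>} t *
     (indicat_real {0..} t * (if X t \<omega> = Some k then 1 else 0)) \<partial>lborel)"
proof -
  have "0 \<le> absorption_time X \<omega>" unfolding absorption_time_def by (rule INF_greatest) simp
  moreover have "(\<Sum>i\<in>UNIV. mat 1 $ i $ k * (if X t \<omega> = Some i then 1 else 0)) = (if X t \<omega> = Some k then 1 else 0 :: real)" for t
    by (simp add: mat_def if_distrib[of "\<lambda>z. z * _"] cong: if_cong)
  ultimately show ?thesis
    unfolding total_reward_def interval_lebesgue_integral_def set_lebesgue_integral_def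
    by (auto simp: einterval_def indicator_def zero_ereal_def intro!: Bochner_Integration.integral_cong)
qed

lemma total_reward_nonneg: "0 \<le> total_reward X (mat 1) \<omega> $ k"
  unfolding total_reward_nth by (intro integral_nonneg_AE) auto

lemma total_reward_measurable: "total_reward X (mat 1) \<in> borel_measurable N"
proof (rule borel_measurable_vec_componentwise)
  fix k
  have "(\<lambda>z. indicat_real {t. 0 < ereal t \<and> ereal t < absorption_time X (fst z)} (snd z)) \<in> borel_measurable (N \<Otimes>\<^sub>M (lborel :: real measure))"
    unfolding indicator_def mem_Collect_eq of_bool_def by measurable
  from borel_measurable_times[OF this state_jointly_measurable[of "Some k"]]
  show "(\<lambda>\<omega>. total_reward X (mat 1) \<omega> $ k) \<in> borel_measurable N"
    unfolding total_reward_nth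
    by (intro lborel.borel_measurable_lebesgue_integral) (simp only: split_def fst_conv snd_conv)
qed

text \<open>The integral up to the absorption time and the integral over the half-line have integrands that
  can differ only at the times 0 and \<open>\<tau>\<close>, because no transient state is visited after absorption.\<close>
lemma total_reward_nth_absorbed:
  assumes \<omega>: "\<omega> \<in> space N" and b: "0 \<le> b" "X b \<omega> = None"
    and stay: "\<forall>s t. 0 \<le> s \<longrightarrow> s \<le> t \<longrightarrow> X s \<omega> = None \<longrightarrow> X t \<omega> = None"
  shows "(\<lambda>m. (\<Sum>k=1..(Suc m)^2. if X (real k / real (Suc m)) \<omega> = Some i then 1 else 0) / real (Suc m))
    \<longlonglongrightarrow> total_reward X (mat 1) \<omega> $ i"
proof -
  define f where "f t = (if X t \<omega> = Some i then 1 else 0 :: real)" for t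
  have rc: "\<forall>\<^sub>F s in at_right t. f s = f t" if "0 \<le> t" for t
    using right_cont[OF \<omega> that] by eventually_elim (simp add: f_def)
  have zero: "f t = 0" if "b \<le> t" for t
    using stay b that by (auto simp: f_def)
  have bound: "\<bar>f t\<bar> \<le> 1" for t by (simp add: f_def)
  note riemann = riemann_sums_of_right_continuous_step_function[where f = f and b = b, OF rc bound zero]
  define \<tau> where "\<tau> = absorption_time X \<omega>"
  have before: "ereal t < \<tau> \<or> ereal t = \<tau> \<or> f t = 0" if "0 \<le> t" for t
  proof (rule ccontr)
    assume "\<not> ?thesis"
    then have "\<tau> < ereal t" "f t \<noteq> 0" by auto
    then obtain s where "0 \<le> s" "X s \<omega> = None" "s < t"
      unfolding \<tau>_def absorption_time_def by (auto simp: INF_less_iff)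
    then have "X t \<omega> = None" using stay less_imp_le by blast
    with \<open>f t \<noteq> 0\<close> show False by (simp add: f_def)
  qed
  have eq: "total_reward X (mat 1) \<omega> $ i = (\<integral>t. indicat_real {0..} t * f t \<partial>lborel)"
    unfolding total_reward_nth f_def[symmetric] \<tau>_def[symmetric]
  proof (rule integral_cong_AE)
    show "AE t in lborel. indicat_real {t. 0 < ereal t \<and> ereal t < \<tau>} t * (indicat_real {0..} t * f t) = indicat_real {0..} t * f t"
      using AE_lborel_singleton[of 0] AE_lborel_singleton[of "real_of_ereal \<tau>"]
    proof eventually_elim
      case (elim t)
      then have "ereal t \<noteq> \<tau>" by auto
      then show ?case using before[of t] elim by (auto simp: indicator_def)
    qed
    have "{t. 0 < ereal t \<and> ereal t < \<tau>} \<in> sets borel" by measurable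
    then show "(\<lambda>t. indicat_real {t. 0 < ereal t \<and> ereal t < \<tau>} t * (indicat_real {0..} t * f t)) \<in> borel_measurable lborel"
      using borel_measurable_times[OF borel_measurable_indicator riemann(2)] by simp
  qed (use riemann(2) in simp)
  show ?thesis using riemann(1) unfolding eq by (simp add: f_def)
qed

text \<open>Kulkarni's formula, as the limit of the identity \<open>expectation (g m) = \<pi> \<bullet> u m\<close> for the
  discounted skeleton of mesh \<open>h m\<close> after \<open>(Suc m)\<^sup>2\<close> steps, that is, at time \<open>Suc m\<close>.\<close>
lemma laplace_total_reward:
  assumes \<theta>: "\<And>i. 0 \<le> \<theta> $ i"
  shows "expectation (\<lambda>\<omega>. exp (- (total_reward X (mat 1) \<omega> \<bullet> \<theta>))) =
    (\<pi> v* matrix_inv (diag_mat \<theta> - T)) \<bullet> exit_rates T"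
proof -
  define h where "h m = 1 / real (Suc m)" for m
  have h_pos: "0 < h m" for m by (simp add: h_def)
  define b :: "nat \<Rightarrow> real^'p" where "b m = (\<chi> i. P (h m) (Some i) None / h m)" for m
  have b_lim: "(\<lambda>m. b m $ i) \<longlonglongrightarrow> exit_rates T $ i" for i
    using exit_probability_tendsto by (simp add: b_def h_def)
  obtain u where u: "\<forall>\<^sub>F m in sequentially. skeleton_matrix \<theta> m *v u m = b m"
    and u_lim: "\<And>i. (\<lambda>m. u m $ i) \<longlonglongrightarrow> (matrix_inv (diag_mat \<theta> - T) *v exit_rates T) $ i"
    by (rule tendsto_linear_system_solution[OF skeleton_matrix_tendsto b_lim
        det_diag_minus_sub_intensity_nonzero[OF sub_intensity \<theta>]]) blast
  \<comment> \<open>The solution \<open>u m\<close> gets the value 1 at the absorbing state, where no discount is applied.\<close>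
  define v where "v m x = (case x of None \<Rightarrow> 1 | Some i \<Rightarrow> u m $ i)" for m x
  define d where "d m x = (case x of None \<Rightarrow> 1 | Some i \<Rightarrow> exp (- (h m * \<theta> $ i)))" for m x
  define W where "W \<omega> = total_reward X (mat 1) \<omega>" for \<omega>
  define g where "g m \<omega> = (\<Prod>k=1..(Suc m)^2. d m (X (real k * h m) \<omega>)) * v m (X (real ((Suc m)^2) * h m) \<omega>)" for m \<omega>
  have harmonic: "v m x = (\<Sum>y\<in>UNIV. P (h m) x y * (d m y * v m y))" if m: "skeleton_matrix \<theta> m *v u m = b m" for m x
  proof (cases x)
    case None then show ?thesis using h_pos[of m] by (simp add: None_absorbing sum_option v_def d_def)
  next
    case (Some i)
    have entry: "skeleton_matrix \<theta> m $ i $ j =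
        ((if i = j then 1 else 0) - P (h m) (Some i) (Some j) * exp (- (h m * \<theta> $ j))) / h m" for j
      by (simp add: skeleton_matrix_def h_def)
    have "b m $ i = (\<Sum>j\<in>UNIV. skeleton_matrix \<theta> m $ i $ j * u m $ j)"
      unfolding m[symmetric] by (simp add: matrix_vector_mult_def)
    also have "\<dots> = (u m $ i - (\<Sum>j\<in>UNIV. P (h m) (Some i) (Some j) * (exp (- (h m * \<theta> $ j)) * u m $ j))) / h m"
      unfolding entry by (simp add: left_diff_distrib sum_subtractf diff_divide_distrib sum_divide_distrib
          if_distrib[of "\<lambda>z. z * _"] if_distrib[of "\<lambda>z. z / _"] mult.assoc cong: if_cong)
    finally have "P (h m) (Some i) None = u m $ i - (\<Sum>j\<in>UNIV. P (h m) (Some i) (Some j) * (exp (- (h m * \<theta> $ j)) * u m $ j))"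
      using h_pos[of m] by (simp add: b_def)
    then show ?thesis by (simp add: Some sum_option v_def d_def)
  qed
  have E_g: "\<forall>\<^sub>F m in sequentially. expectation (g m) = \<pi> \<bullet> u m"
    using u
  proof eventually_elim
    case (elim m)
    have "expectation (g m) = (\<Sum>x\<in>UNIV. transient_initial \<pi> x * v m x)"
      unfolding g_def by (rule expectation_discounted_skeleton[OF less_imp_le[OF h_pos] harmonic[OF elim]])
    then show ?case by (simp add: sum_option v_def inner_vec_def)
  qed
  have "(\<lambda>m. \<pi> \<bullet> u m) \<longlonglongrightarrow> \<pi> \<bullet> (matrix_inv (diag_mat \<theta> - T) *v exit_rates T)"
    unfolding inner_vec_def by (intro tendsto_intros u_lim)
  then have lim1: "(\<lambda>m. expectation (g m)) \<longlonglongrightarrow> \<pi> \<bullet> (matrix_inv (diag_mat \<theta> - T) *v exit_rates T)"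
    by (rule Lim_transform_eventually) (use E_g in eventually_elim, simp)
  \<comment> \<open>A convergent sequence of solutions is bounded, which provides the dominating constant.\<close>
  have "\<exists>C. \<forall>m x. \<bar>v m x\<bar> \<le> C"
  proof -
    have "\<exists>c. \<forall>m. \<bar>u m $ i\<bar> \<le> c" for i
      using convergent_imp_Bseq[OF convergentI[OF u_lim[of i]]] by (auto simp: Bseq_def)
    then obtain c where c: "\<And>i m. \<bar>u m $ i\<bar> \<le> c i" by metis
    have "\<bar>v m x\<bar> \<le> 1 + (\<Sum>i\<in>UNIV. \<bar>c i\<bar>)" for m x
    proof (cases x)
      case None then show ?thesis by (simp add: v_def sum_nonneg)
    next
      case (Some i)
      have "\<bar>u m $ i\<bar> \<le> \<bar>c i\<bar>" using c[of m i] by linarith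
      also have "\<dots> \<le> (\<Sum>i\<in>UNIV. \<bar>c i\<bar>)" by (rule member_le_sum) auto
      finally show ?thesis by (simp add: v_def Some)
    qed
    then show ?thesis by blast
  qed
  then obtain C where C: "\<And>m x. \<bar>v m x\<bar> \<le> C" by blast
  have d_bound: "0 \<le> d m x" "d m x \<le> 1" for m x
    using \<theta> h_pos[of m] by (auto simp: d_def split: option.split intro!: mult_nonneg_nonneg less_imp_le)
  have g_bound: "\<bar>g m \<omega>\<bar> \<le> C" for m \<omega>
  proof -
    have "\<bar>\<Prod>k=1..(Suc m)^2. d m (X (real k * h m) \<omega>)\<bar> \<le> 1"
      using d_bound by (simp add: abs_of_nonneg prod_nonneg prod_le_1)
    then have "\<bar>g m \<omega>\<bar> \<le> 1 * C" unfolding g_def abs_mult by (intro mult_mono C) auto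
    then show ?thesis by simp
  qed
  have g_meas: "g m \<in> borel_measurable N" for m
    unfolding g_def using h_pos[of m]
    by (intro borel_measurable_times borel_measurable_prod fX_measurable[where f = "d m"] fX_measurable[where f = "v m"]) auto
  have W_meas: "(\<lambda>\<omega>. exp (- (W \<omega> \<bullet> \<theta>))) \<in> borel_measurable N"
    using total_reward_measurable unfolding W_def by measurable
  have "AE \<omega> in N. (\<lambda>m. g m \<omega>) \<longlonglongrightarrow> exp (- (W \<omega> \<bullet> \<theta>))"
    using AE_space AE_absorption AE_absorbing_state[OF absorbing_intensity.simps(3)]
  proof eventually_elim
    case (elim \<omega>)
    then obtain t where t: "0 \<le> t" "X t \<omega> = None" by blast
    define s where "s m i = (\<Sum>k=1..(Suc m)^2. if X (real k / real (Suc m)) \<omega> = Some i then 1 else 0) / real (Suc m)" for m i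
    have s_lim: "(\<lambda>m. s m i) \<longlonglongrightarrow> W \<omega> $ i" for i
      unfolding s_def W_def by (rule total_reward_nth_absorbed[OF elim(1) t elim(3)])
    have d_exp: "d m x = exp (- (\<Sum>i\<in>UNIV. h m * \<theta> $ i * (if x = Some i then 1 else 0)))" for m x
      by (cases x) (simp_all add: d_def if_distrib[of "\<lambda>z. _ * z"] cong: if_cong)
    \<comment> \<open>The discount factor is the exponential of the Riemann sums \<open>s m\<close> for the sojourn times.\<close>
    have prod: "(\<Prod>k=1..(Suc m)^2. d m (X (real k * h m) \<omega>)) = exp (- (\<Sum>i\<in>UNIV. s m i * \<theta> $ i))" for m
    proof -
      have "(\<Prod>k=1..(Suc m)^2. d m (X (real k * h m) \<omega>)) =
          exp (\<Sum>k=1..(Suc m)^2. - (\<Sum>i\<in>UNIV. h m * \<theta> $ i * (if X (real k * h m) \<omega> = Some i then 1 else 0)))"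
        unfolding d_exp by (simp add: exp_sum)
      also have "(\<Sum>k=1..(Suc m)^2. - (\<Sum>i\<in>UNIV. h m * \<theta> $ i * (if X (real k * h m) \<omega> = Some i then 1 else 0))) =
          - (\<Sum>i\<in>UNIV. \<Sum>k=1..(Suc m)^2. h m * \<theta> $ i * (if X (real k * h m) \<omega> = Some i then 1 else 0))"
        by (subst sum.swap) (simp add: sum_negf)
      also have "\<dots> = - (\<Sum>i\<in>UNIV. s m i * \<theta> $ i)"
      proof -
        have "(\<Sum>k=1..(Suc m)^2. h m * \<theta> $ i * (if X (real k * h m) \<omega> = Some i then 1 else 0)) = s m i * \<theta> $ i" for i
          unfolding sum_distrib_left[symmetric] s_def by (simp add: h_def)
        then show ?thesis by simp
      qed
      finally show ?thesis .
    qed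
    \<comment> \<open>The path is absorbed by time \<open>t\<close>, so at the horizon \<open>Suc m \<ge> n > t\<close> the harmonic function equals 1.\<close>
    obtain n :: nat where n: "t < real n" using reals_Archimedean2 by blast
    have "v m (X (real ((Suc m)^2) * h m) \<omega>) = 1" if "n \<le> m" for m
    proof -
      have "real ((Suc m)^2) * h m = real (Suc m)" by (simp only: h_def power2_eq_square of_nat_mult) simp
      moreover have "X (real (Suc m)) \<omega> = None"
        using elim(3)[rule_format, of t "real (Suc m)"] t n that by simp
      ultimately show ?thesis by (simp add: v_def)
    qed
    then have "\<forall>\<^sub>F m in sequentially. exp (- (\<Sum>i\<in>UNIV. s m i * \<theta> $ i)) = g m \<omega>"
      unfolding eventually_sequentially g_def prod by (intro exI[of _ n]) simp
    moreover have "(\<lambda>m. exp (- (\<Sum>i\<in>UNIV. s m i * \<theta> $ i))) \<longlonglongrightarrow> exp (- (\<Sum>i\<in>UNIV. W \<omega> $ i * \<theta> $ i))"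
      by (intro tendsto_intros s_lim)
    ultimately show ?case by (simp add: inner_vec_def Lim_transform_eventually)
  qed
  then have lim2: "(\<lambda>m. expectation (g m)) \<longlonglongrightarrow> expectation (\<lambda>\<omega>. exp (- (W \<omega> \<bullet> \<theta>)))"
    by (intro integral_dominated_convergence[where w = "\<lambda>_. C"]) (use g_bound g_meas W_meas in auto)
  have "expectation (\<lambda>\<omega>. exp (- (W \<omega> \<bullet> \<theta>))) = \<pi> \<bullet> (matrix_inv (diag_mat \<theta> - T) *v exit_rates T)"
    by (rule LIMSEQ_unique[OF lim2 lim1])
  then show ?thesis by (simp add: W_def dot_lmul_matrix)
qed

end

section \<open>Mixtures of positive stable vectors\<close>

lemma indep_var_integral_eq:
  fixes f :: "'x \<times> 'x \<Rightarrow> real"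
  assumes "prob_space M" and ind: "prob_space.indep_var M A U B V"
    and f: "f \<in> borel_measurable (A \<Otimes>\<^sub>M B)" and bound: "\<And>z. \<bar>f z\<bar> \<le> C"
  shows "(\<integral>\<omega>. f (U \<omega>, V \<omega>) \<partial>M) = (\<integral>\<omega>. (\<integral>\<omega>'. f (U \<omega>, V \<omega>') \<partial>M) \<partial>M)"
proof -
  interpret prob_space M by fact
  have [measurable]: "U \<in> measurable M A" "V \<in> measurable M B"
    using indep_var_rv1[OF ind] indep_var_rv2[OF ind] by auto
  interpret U: prob_space "distr M A U" by (rule prob_space_distr) simp
  interpret V: prob_space "distr M B V" by (rule prob_space_distr) simp
  interpret UV: pair_prob_space "distr M A U" "distr M B V" ..
  have joint: "distr M (A \<Otimes>\<^sub>M B) (\<lambda>\<omega>. (U \<omega>, V \<omega>)) = distr M A U \<Otimes>\<^sub>M distr M B V"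
    using ind by (simp add: indep_var_distribution_eq)
  have int: "integrable (distr M A U \<Otimes>\<^sub>M distr M B V) f"
    by (rule UV.P.integrable_const_bound[where B = C]) (use f bound in \<open>auto simp: measurable_def[symmetric]\<close>)
  have "(\<integral>\<omega>. f (U \<omega>, V \<omega>) \<partial>M) = (\<integral>z. f z \<partial>distr M (A \<Otimes>\<^sub>M B) (\<lambda>\<omega>. (U \<omega>, V \<omega>)))"
    by (rule integral_distr[symmetric]) (use f in auto)
  also have "\<dots> = (\<integral>x. (\<integral>y. f (x, y) \<partial>distr M B V) \<partial>distr M A U)"
    unfolding joint by (rule UV.integral_fst'[OF int, symmetric])
  also have "\<dots> = (\<integral>x. (\<integral>\<omega>'. f (x, V \<omega>') \<partial>M) \<partial>distr M A U)"
  proof (rule Bochner_Integration.integral_cong[OF refl])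
    fix x assume "x \<in> space (distr M A U)"
    then have "(\<lambda>y. f (x, y)) \<in> borel_measurable B" using f by (intro measurable_compose[OF _ f]) auto
    then show "(\<integral>y. f (x, y) \<partial>distr M B V) = (\<integral>\<omega>'. f (x, V \<omega>') \<partial>M)"
      by (intro integral_distr) auto
  qed
  also have "\<dots> = (\<integral>\<omega>. (\<integral>\<omega>'. f (U \<omega>, V \<omega>') \<partial>M) \<partial>M)"
  proof (rule integral_distr)
    have "(\<lambda>z. f (fst z, V (snd z))) \<in> borel_measurable (A \<Otimes>\<^sub>M M)"
      by (rule measurable_compose[OF _ f]) measurable
    then show "(\<lambda>x. \<integral>\<omega>'. f (x, V \<omega>') \<partial>M) \<in> borel_measurable A"
      by (intro borel_measurable_lebesgue_integral) (simp add: split_def)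
  qed simp
  finally show ?thesis .
qed

lemma AE_positive_stable_vector:
  fixes S :: "'c \<Rightarrow> real^'p"
  assumes "\<And>i. positive_stable_rv \<alpha> M (\<lambda>\<omega>. S \<omega> $ i)"
  shows "AE \<omega> in M. \<forall>i. 0 < S \<omega> $ i"
  using assms unfolding positive_stable_rv_def by (intro eventually_all_finite) blast

text \<open>The absolute values do not change the integral, as stable variables are almost surely positive,
  but they keep the integrand between 0 and 1 at every sample point.\<close>
lemma laplace_scaled_stable_vector:
  fixes S :: "'c \<Rightarrow> real^'p"
  assumes "prob_space M" and S [measurable]: "S \<in> borel_measurable M"
    and stable: "\<And>i. positive_stable_rv \<alpha> M (\<lambda>\<omega>. S \<omega> $ i)"
    and indep: "prob_space.indep_vars M (\<lambda>_. borel) (\<lambda>i \<omega>. S \<omega> $ i) UNIV"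
    and a: "\<And>i. 0 \<le> a $ i"
  shows "(\<integral>\<omega>. exp (- (\<Sum>i\<in>UNIV. a $ i * \<bar>S \<omega> $ i\<bar>)) \<partial>M) = exp (- (\<Sum>i\<in>UNIV. a $ i powr \<alpha>))"
proof -
  interpret prob_space M by fact
  have "indep_vars (\<lambda>_. borel) (\<lambda>i \<omega>. exp (- (a $ i * \<bar>S \<omega> $ i\<bar>))) UNIV"
    by (rule indep_vars_compose2[OF indep]) simp
  then have "(\<integral>\<omega>. (\<Prod>i\<in>UNIV. exp (- (a $ i * \<bar>S \<omega> $ i\<bar>))) \<partial>M) =
      (\<Prod>i\<in>UNIV. \<integral>\<omega>. exp (- (a $ i * \<bar>S \<omega> $ i\<bar>)) \<partial>M)"
    by (intro indep_vars_lebesgue_integral) (auto intro!: integrable_const_bound[where B = 1] simp: a)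
  also have "\<dots> = (\<Prod>i\<in>UNIV. exp (- (a $ i powr \<alpha>)))"
  proof (rule prod.cong[OF refl])
    fix i
    have "(\<integral>\<omega>. exp (- (a $ i * \<bar>S \<omega> $ i\<bar>)) \<partial>M) = (\<integral>\<omega>. exp (- (a $ i * S \<omega> $ i)) \<partial>M)"
    proof (rule integral_cong_AE)
      show "AE \<omega> in M. exp (- (a $ i * \<bar>S \<omega> $ i\<bar>)) = exp (- (a $ i * S \<omega> $ i))"
        using AE_positive_stable_vector[OF stable] by eventually_elim (simp add: less_imp_le)
    qed auto
    also have "\<dots> = exp (- (a $ i powr \<alpha>))"
      using stable[of i] a[of i] by (simp add: positive_stable_rv_def)
    finally show "(\<integral>\<omega>. exp (- (a $ i * \<bar>S \<omega> $ i\<bar>)) \<partial>M) = exp (- (a $ i powr \<alpha>))" .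
  qed
  finally show ?thesis by (simp add: exp_sum sum_negf flip: exp_sum)
qed

text \<open>Conditioning on \<open>W\<close> and the identity \<open>(w\<^sup>1\<^sup>/\<^sup>\<alpha> c)\<^sup>\<alpha> = w c\<^sup>\<alpha>\<close> for \<open>w \<ge> 0\<close>, which also holds at
  \<open>w = 0\<close> since \<open>0 powr a = 0\<close>.\<close>
lemma laplace_stable_mixture:
  fixes W S :: "'c \<Rightarrow> real^'p"
  assumes "prob_space M" and W [measurable]: "W \<in> borel_measurable M" and S [measurable]: "S \<in> borel_measurable M"
    and "0 < \<alpha>"
    and W_nonneg: "AE \<omega> in M. \<forall>i. 0 \<le> W \<omega> $ i"
    and stable: "\<And>i. positive_stable_rv \<alpha> M (\<lambda>\<omega>. S \<omega> $ i)"
    and indep: "prob_space.indep_vars M (\<lambda>_. borel) (\<lambda>i \<omega>. S \<omega> $ i) UNIV"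
    and indep_WS: "prob_space.indep_var M borel W borel S"
    and c: "\<And>i. 0 \<le> c $ i"
  shows "(\<integral>\<omega>. exp (- (schur_mult (vec_powr (W \<omega>) (1 / \<alpha>)) (S \<omega>) \<bullet> c)) \<partial>M) =
    (\<integral>\<omega>. exp (- (W \<omega> \<bullet> vec_powr c \<alpha>)) \<partial>M)"
proof -
  interpret prob_space M by fact
  \<comment> \<open>Bounded for all \<open>w\<close> and \<open>s\<close>, as needed for Fubini's theorem: \<open>powr\<close> is never negative.\<close>
  define f where "f = (\<lambda>(w :: real^'p, s :: real^'p). exp (- (\<Sum>i\<in>UNIV. w $ i powr (1 / \<alpha>) * c $ i * \<bar>s $ i\<bar>)))"
  have f: "f \<in> borel_measurable (borel \<Otimes>\<^sub>M borel)" unfolding f_def by measurable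
  have bound: "\<bar>f z\<bar> \<le> 1" for z
    using c by (auto simp: f_def split_def intro!: sum_nonneg)
  have "AE \<omega> in M. exp (- (schur_mult (vec_powr (W \<omega>) (1 / \<alpha>)) (S \<omega>) \<bullet> c)) = f (W \<omega>, S \<omega>)"
    using AE_positive_stable_vector[OF stable]
    by eventually_elim (simp add: f_def schur_mult_def vec_powr_def inner_vec_def less_imp_le ac_simps)
  then have "(\<integral>\<omega>. exp (- (schur_mult (vec_powr (W \<omega>) (1 / \<alpha>)) (S \<omega>) \<bullet> c)) \<partial>M) = (\<integral>\<omega>. f (W \<omega>, S \<omega>) \<partial>M)"
    by (intro integral_cong_AE)
       (auto simp: schur_mult_def vec_powr_def inner_vec_def f_def)
  also have "\<dots> = (\<integral>\<omega>. (\<integral>\<omega>'. f (W \<omega>, S \<omega>') \<partial>M) \<partial>M)"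
    by (rule indep_var_integral_eq[OF \<open>prob_space M\<close> indep_WS f bound])
  also have "\<dots> = (\<integral>\<omega>. exp (- (\<Sum>i\<in>UNIV. (W \<omega> $ i powr (1 / \<alpha>) * c $ i) powr \<alpha>)) \<partial>M)"
  proof (rule Bochner_Integration.integral_cong[OF refl])
    fix \<omega>
    show "(\<integral>\<omega>'. f (W \<omega>, S \<omega>') \<partial>M) = exp (- (\<Sum>i\<in>UNIV. (W \<omega> $ i powr (1 / \<alpha>) * c $ i) powr \<alpha>))"
      using laplace_scaled_stable_vector[OF \<open>prob_space M\<close> S stable indep, of "\<chi> i. W \<omega> $ i powr (1 / \<alpha>) * c $ i"] c
      by (simp add: f_def)
  qed
  also have "\<dots> = (\<integral>\<omega>. exp (- (W \<omega> \<bullet> vec_powr c \<alpha>)) \<partial>M)"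
  proof (rule integral_cong_AE)
    show "AE \<omega> in M. exp (- (\<Sum>i\<in>UNIV. (W \<omega> $ i powr (1 / \<alpha>) * c $ i) powr \<alpha>)) = exp (- (W \<omega> \<bullet> vec_powr c \<alpha>))"
      using W_nonneg
    proof eventually_elim
      case (elim \<omega>)
      have "(W \<omega> $ i powr (1 / \<alpha>) * c $ i) powr \<alpha> = W \<omega> $ i * c $ i powr \<alpha>" for i
        using elim c[of i] \<open>0 < \<alpha>\<close> by (simp add: powr_mult powr_powr)
      then show ?case by (simp add: inner_vec_def vec_powr_def)
    qed
  qed (auto simp: inner_vec_def)
  finally show ?thesis .
qed

section \<open>Phase-type scale mixtures of stable vectors\<close>

theorem theorem3p7:
  fixes \<pi> :: "real^'p" and T :: "real^'p^'p" and R :: "real^'n^'p" and \<alpha> :: real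
    and M :: "'a measure" and Y :: "'a \<Rightarrow> real^'n"
    and M' :: "'c measure" and W S :: "'c \<Rightarrow> real^'p"
  assumes "probability_vector \<pi>" and "sub_intensity_matrix T" and "nonneg_matrix R"
    and "0 < \<alpha>" and "\<alpha> \<le> 1"
    and "prob_space M" and "Y \<in> borel_measurable M"
    and "AE \<omega> in M. \<forall>j. 0 \<le> Y \<omega> $ j"
    and "\<And>\<theta> :: real^'n. (\<forall>j. 0 \<le> \<theta> $ j) \<Longrightarrow>
      (\<integral>\<omega>. exp (- (Y \<omega> \<bullet> \<theta>)) \<partial>M) =
      (\<pi> v* matrix_inv (diag_mat (vec_powr (R *v \<theta>) \<alpha>) - T)) \<bullet> exit_rates T"
    and "prob_space M'" and "W \<in> borel_measurable M'" and "S \<in> borel_measurable M'"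
    and "MPH_star TYPE('b) \<pi> T (mat 1 :: real^'p^'p) (distr M' borel W)"
    and "\<And>i. positive_stable_rv \<alpha> M' (\<lambda>\<omega>. S \<omega> $ i)"
    and "prob_space.indep_vars M' (\<lambda>_. borel) (\<lambda>i \<omega>. S \<omega> $ i) UNIV"
    and "prob_space.indep_var M' borel W borel S"
  shows "distr M borel Y =
    distr M' borel (\<lambda>\<omega>. transpose R *v schur_mult (vec_powr (W \<omega>) (1 / \<alpha>)) (S \<omega>))"
proof -
  interpret M: prob_space M by fact
  interpret M': prob_space M' by fact
  note [measurable] = \<open>Y \<in> borel_measurable M\<close> \<open>W \<in> borel_measurable M'\<close> \<open>S \<in> borel_measurable M'\<close>
  define Z where "Z \<omega> = transpose R *v schur_mult (vec_powr (W \<omega>) (1 / \<alpha>)) (S \<omega>)" for \<omega>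
  obtain N :: "'b measure" and X
    where mjp: "markov_jump_process N X (transient_initial \<pi>) (absorbing_intensity T)"
      and W_law: "distr M' borel W = distr N borel (total_reward X (mat 1))"
    using \<open>MPH_star TYPE('b) \<pi> T (mat 1 :: real^'p^'p) (distr M' borel W)\<close> unfolding MPH_star_def by blast
  obtain P where "jump_process N X (transient_initial \<pi>) (absorbing_intensity T) P"
    using markov_jump_process_imp_jump_process[OF mjp] by blast
  then interpret absorbing_jump_process N X \<pi> T P
    using \<open>sub_intensity_matrix T\<close> by (simp add: absorbing_jump_process_def absorbing_jump_process_axioms_def)
  note [measurable] = total_reward_measurable
  have laplace_W: "(\<integral>\<omega>. exp (- (W \<omega> \<bullet> c)) \<partial>M') = (\<pi> v* matrix_inv (diag_mat c - T)) \<bullet> exit_rates T"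
    if "\<And>i. 0 \<le> c $ i" for c
  proof -
    have "(\<integral>\<omega>. exp (- (W \<omega> \<bullet> c)) \<partial>M') = (\<integral>x. exp (- (x \<bullet> c)) \<partial>distr M' borel W)"
      by (rule integral_distr[symmetric]) auto
    also have "\<dots> = expectation (\<lambda>\<omega>. exp (- (total_reward X (mat 1) \<omega> \<bullet> c)))"
      unfolding W_law by (rule integral_distr) auto
    finally show ?thesis using laplace_total_reward[OF that] by simp
  qed
  have "AE x in distr N borel (total_reward X (mat 1)). \<forall>i. 0 \<le> x $ i"
    by (subst AE_distr_iff) (auto simp: total_reward_nonneg)
  then have W_nonneg: "AE \<omega> in M'. \<forall>i. 0 \<le> W \<omega> $ i"
    unfolding W_law[symmetric] by (subst (asm) AE_distr_iff) auto
  have S_pos: "AE \<omega> in M'. \<forall>i. 0 < S \<omega> $ i"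
    by (rule AE_positive_stable_vector) (rule assms(14))
  have Z [measurable]: "Z \<in> borel_measurable M'"
    unfolding Z_def
    by (rule borel_measurable_vec_componentwise) (simp add: matrix_vector_mult_def schur_mult_def vec_powr_def)
  have Z_nonneg: "AE \<omega> in M'. \<forall>j. 0 \<le> Z \<omega> $ j"
    using S_pos
  proof eventually_elim
    case (elim \<omega>)
    then show ?case
      using \<open>nonneg_matrix R\<close>
      by (auto simp: Z_def matrix_vector_mult_def schur_mult_def vec_powr_def transpose_def nonneg_matrix_def
          less_imp_le intro!: sum_nonneg mult_nonneg_nonneg)
  qed
  have "distr M borel Y = distr M' borel Z"
  proof (rule laplace_transform_unique)
    show "AE x in distr M borel Y. \<forall>j. 0 \<le> x $ j"
      using assms(8) by (subst AE_distr_iff) auto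
    show "AE x in distr M' borel Z. \<forall>j. 0 \<le> x $ j"
      using Z_nonneg by (subst AE_distr_iff) auto
    fix \<theta> :: "real^'n" assume \<theta>: "\<forall>j. 0 \<le> \<theta> $ j"
    define c where "c = R *v \<theta>"
    have c: "0 \<le> c $ i" for i
      using \<theta> \<open>nonneg_matrix R\<close>
      by (auto simp: c_def matrix_vector_mult_def nonneg_matrix_def intro!: sum_nonneg mult_nonneg_nonneg)
    have "(\<integral>x. exp (- (x \<bullet> \<theta>)) \<partial>distr M' borel Z) = (\<integral>\<omega>. exp (- (Z \<omega> \<bullet> \<theta>)) \<partial>M')"
      by (rule integral_distr) auto
    also have "\<dots> = (\<integral>\<omega>. exp (- (schur_mult (vec_powr (W \<omega>) (1 / \<alpha>)) (S \<omega>) \<bullet> c)) \<partial>M')"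
      by (simp add: Z_def c_def dot_lmul_matrix)
    also have "\<dots> = (\<integral>\<omega>. exp (- (W \<omega> \<bullet> vec_powr c \<alpha>)) \<partial>M')"
      by (rule laplace_stable_mixture) (use assms W_nonneg c in auto)
    also have "\<dots> = (\<pi> v* matrix_inv (diag_mat (vec_powr c \<alpha>) - T)) \<bullet> exit_rates T"
      by (rule laplace_W) (simp add: vec_powr_def)
    also have "\<dots> = (\<integral>\<omega>. exp (- (Y \<omega> \<bullet> \<theta>)) \<partial>M)"
      using assms(9)[OF \<theta>] by (simp add: c_def)
    also have "\<dots> = (\<integral>x. exp (- (x \<bullet> \<theta>)) \<partial>distr M borel Y)"
      by (rule integral_distr[symmetric]) auto
    finally show "(\<integral>x. exp (- (x \<bullet> \<theta>)) \<partial>distr M borel Y) = (\<integral>x. exp (- (x \<bullet> \<theta>)) \<partial>distr M' borel Z)" ..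
  qed (auto intro: M.prob_space_distr M'.prob_space_distr)
  then show ?thesis unfolding Z_def .
qed

end
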